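(* For any graph story $\langle G,\tau,W\rangle$ in which $G$ is a path with $n$ vertices, one can compute in $O(n)$ time a drawing story of $\langle G,\tau,W\rangle$ that is planar, straight-line, and lies on a $2W\times 2W$ grid.
   Context: A graph story $\langle G,\tau,W\rangle$ consists of a graph $G$ with $n$ vertices, a bijection $\tau:V(G)\to\{1,\dots,n\}$, and a positive integer $W$ (the window size); for $t=1,\dots,n+W-1$, $G_t$ is the subgraph of $G$ induced by $\{v: t-W<\tau(v)\leq t\}$. A drawing story is a sequence $\Gamma_1,\dots,\Gamma_{n+W-1}$ where $\Gamma_t$ is a drawing of $G_t$, every vertex is drawn at the same point in all $\Gamma_t$ containing it, and every edge is drawn by the same curve in all $\Gamma_t$ containing it. It is planar (resp. straight-line) if every $\Gamma_t$ is planar (resp. draws edges as straight-line segments). It lies on a $w\times h$ grid if all vertices are placed at integer-coordinate points of a grid $[a,b]\times[c,d]$ (integers) with $b-a+1=w$ and $d-c+1=h$, and all drawings lie within its bounding box. *)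

theory Defs
  imports "HOL-Analysis.Analysis"
begin

section \<open>Graph stories\<close>

definition simple_graph :: "'a set \<Rightarrow> 'a set set \<Rightarrow> bool" where
  "simple_graph V E \<longleftrightarrow> finite V \<and> (\<forall>e\<in>E. e \<subseteq> V \<and> card e = 2)"

text \<open>A path has at least one vertex; the list gives the vertices in path order.\<close>

definition path_graph :: "'a set \<Rightarrow> 'a set set \<Rightarrow> bool" where
  "path_graph V E \<longleftrightarrow>
     (\<exists>p. p \<noteq> [] \<and> distinct p \<and> set p = V \<and>
          E = {{p ! i, p ! Suc i} | i. Suc i < length p})"

definition graph_story :: "'a set \<Rightarrow> 'a set set \<Rightarrow> ('a \<Rightarrow> nat) \<Rightarrow> nat \<Rightarrow> bool" where
  "graph_story V E \<tau> W \<longleftrightarrow> simple_graph V E \<and> bij_betw \<tau> V {1..card V} \<and> W > 0"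

definition story_verts :: "'a set \<Rightarrow> ('a \<Rightarrow> nat) \<Rightarrow> nat \<Rightarrow> nat \<Rightarrow> 'a set" where
  "story_verts V \<tau> W t = {v \<in> V. int t - int W < int (\<tau> v) \<and> \<tau> v \<le> t}"

definition story_edges :: "'a set \<Rightarrow> 'a set set \<Rightarrow> ('a \<Rightarrow> nat) \<Rightarrow> nat \<Rightarrow> nat \<Rightarrow> 'a set set" where
  "story_edges V E \<tau> W t = {e \<in> E. e \<subseteq> story_verts V \<tau> W t}"


section \<open>Drawings\<close>

text \<open>A curve is recorded as its set of points. Only the values at vertices and edges of the
  graph being drawn are meaningful.\<close>

record 'a drawing =
  point :: "'a \<Rightarrow> real \<times> real"
  curve :: "'a set \<Rightarrow> (real \<times> real) set"

definition is_drawing :: "'a set \<Rightarrow> 'a set set \<Rightarrow> 'a drawing \<Rightarrow> bool" where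
  "is_drawing V E D \<longleftrightarrow>
     inj_on (point D) V \<and>
     (\<forall>e\<in>E. \<exists>g. arc g \<and> path_image g = curve D e \<and>
                {pathstart g, pathfinish g} = point D ` e)"

definition planar_drawing :: "'a set \<Rightarrow> 'a set set \<Rightarrow> 'a drawing \<Rightarrow> bool" where
  "planar_drawing V E D \<longleftrightarrow>
     (\<forall>e\<in>E. \<forall>v\<in>V. v \<notin> e \<longrightarrow> point D v \<notin> curve D e) \<and>
     (\<forall>e\<in>E. \<forall>f\<in>E. e \<noteq> f \<longrightarrow> curve D e \<inter> curve D f \<subseteq> point D ` (e \<inter> f))"

definition straight_line_drawing :: "'a set set \<Rightarrow> 'a drawing \<Rightarrow> bool" where
  "straight_line_drawing E D \<longleftrightarrow>
     (\<forall>u v. {u, v} \<in> E \<longrightarrow> curve D {u, v} = closed_segment (point D u) (point D v))"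


section \<open>Drawing stories\<close>

definition drawing_story ::
    "'a set \<Rightarrow> 'a set set \<Rightarrow> ('a \<Rightarrow> nat) \<Rightarrow> nat \<Rightarrow> (nat \<Rightarrow> 'a drawing) \<Rightarrow> bool" where
  "drawing_story V E \<tau> W \<Gamma> \<longleftrightarrow>
     (\<forall>t\<in>{1..card V + W - 1}.
        is_drawing (story_verts V \<tau> W t) (story_edges V E \<tau> W t) (\<Gamma> t)) \<and>
     (\<forall>s\<in>{1..card V + W - 1}. \<forall>t\<in>{1..card V + W - 1}.
        (\<forall>v \<in> story_verts V \<tau> W s \<inter> story_verts V \<tau> W t. point (\<Gamma> s) v = point (\<Gamma> t) v) \<and>
        (\<forall>e \<in> story_edges V E \<tau> W s \<inter> story_edges V E \<tau> W t. curve (\<Gamma> s) e = curve (\<Gamma> t) e))"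

definition planar_story ::
    "'a set \<Rightarrow> 'a set set \<Rightarrow> ('a \<Rightarrow> nat) \<Rightarrow> nat \<Rightarrow> (nat \<Rightarrow> 'a drawing) \<Rightarrow> bool" where
  "planar_story V E \<tau> W \<Gamma> \<longleftrightarrow>
     (\<forall>t\<in>{1..card V + W - 1}.
        planar_drawing (story_verts V \<tau> W t) (story_edges V E \<tau> W t) (\<Gamma> t))"

definition straight_line_story ::
    "'a set \<Rightarrow> 'a set set \<Rightarrow> ('a \<Rightarrow> nat) \<Rightarrow> nat \<Rightarrow> (nat \<Rightarrow> 'a drawing) \<Rightarrow> bool" where
  "straight_line_story V E \<tau> W \<Gamma> \<longleftrightarrow>
     (\<forall>t\<in>{1..card V + W - 1}. straight_line_drawing (story_edges V E \<tau> W t) (\<Gamma> t))"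

definition story_on_grid ::
    "'a set \<Rightarrow> 'a set set \<Rightarrow> ('a \<Rightarrow> nat) \<Rightarrow> nat \<Rightarrow> (nat \<Rightarrow> 'a drawing) \<Rightarrow> nat \<Rightarrow> nat \<Rightarrow> bool" where
  "story_on_grid V E \<tau> W \<Gamma> w h \<longleftrightarrow>
     (\<exists>a b c d :: int. b - a + 1 = int w \<and> d - c + 1 = int h \<and>
        (\<forall>t\<in>{1..card V + W - 1}.
           (\<forall>v \<in> story_verts V \<tau> W t. \<exists>x\<in>{a..b}. \<exists>y\<in>{c..d}.
               point (\<Gamma> t) v = (of_int x, of_int y)) \<and>
           (\<forall>e \<in> story_edges V E \<tau> W t.
               curve (\<Gamma> t) e \<subseteq> {of_int a..of_int b} \<times> {of_int c..of_int d})))"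


section \<open>Random access machine\<close>

text \<open>
  Running time is measured on a unit-cost word RAM: a program uses fixed registers and an
  integer-addressed memory with indirect addressing, can add, subtract and compare, and
  pays one unit per instruction and per test. Control flow is structured instead of using
  jumps, which changes running times by at most a constant factor.

  The parameter \<open>M\<close> is the word bound: execution is stuck if a computed value
  exceeds \<open>M\<close> in absolute value, or if an address is negative or larger than \<open>M\<close>. This keeps
  the unit cost honest, since repeated doubling would otherwise create exponentially
  large numbers.
\<close>

datatype operand = Imm int | Reg nat

datatype prog =
    Skip
  | Move nat operand
  | Add nat operand operand
  | Sub nat operand operand
  | Load nat operand
  | Store operand operand
  | Seq prog prog
  | IfLess operand operand prog prog
  | WhileLess operand operand prog

type_synonym ram_state = "(nat \<Rightarrow> int) \<times> (nat \<Rightarrow> int)"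

fun opval :: "(nat \<Rightarrow> int) \<Rightarrow> operand \<Rightarrow> int" where
  "opval r (Imm i) = i"
| "opval r (Reg k) = r k"

text \<open>\<open>exec M p s k s'\<close>: with word bound \<open>M\<close>, program \<open>p\<close> started in state \<open>s\<close> (registers,
  memory) halts in state \<open>s'\<close> after exactly \<open>k\<close> steps.\<close>

inductive exec :: "nat \<Rightarrow> prog \<Rightarrow> ram_state \<Rightarrow> nat \<Rightarrow> ram_state \<Rightarrow> bool" for M :: nat where
  Skip: "exec M Skip s 1 s"
| Move: "\<bar>opval r a\<bar> \<le> int M \<Longrightarrow>
    exec M (Move d a) (r, m) 1 (r(d := opval r a), m)"
| Add: "\<bar>opval r a + opval r b\<bar> \<le> int M \<Longrightarrow>
    exec M (Add d a b) (r, m) 1 (r(d := opval r a + opval r b), m)"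
| Sub: "\<bar>opval r a - opval r b\<bar> \<le> int M \<Longrightarrow>
    exec M (Sub d a b) (r, m) 1 (r(d := opval r a - opval r b), m)"
| Load: "0 \<le> opval r a \<Longrightarrow> opval r a \<le> int M \<Longrightarrow>
    exec M (Load d a) (r, m) 1 (r(d := m (nat (opval r a))), m)"
| Store: "0 \<le> opval r a \<Longrightarrow> opval r a \<le> int M \<Longrightarrow> \<bar>opval r b\<bar> \<le> int M \<Longrightarrow>
    exec M (Store a b) (r, m) 1 (r, m(nat (opval r a) := opval r b))"
| Seq: "exec M p s k s' \<Longrightarrow> exec M q s' l s'' \<Longrightarrow>
    exec M (Seq p q) s (k + l) s''"
| IfTrue: "opval r a < opval r b \<Longrightarrow> exec M p (r, m) k s' \<Longrightarrow>
    exec M (IfLess a b p q) (r, m) (k + 1) s'"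
| IfFalse: "\<not> opval r a < opval r b \<Longrightarrow> exec M q (r, m) k s' \<Longrightarrow>
    exec M (IfLess a b p q) (r, m) (k + 1) s'"
| WhileFalse: "\<not> opval r a < opval r b \<Longrightarrow>
    exec M (WhileLess a b p) (r, m) 1 (r, m)"
| WhileTrue: "opval r a < opval r b \<Longrightarrow> exec M p (r, m) k s' \<Longrightarrow>
    exec M (WhileLess a b p) s' l s'' \<Longrightarrow>
    exec M (WhileLess a b p) (r, m) (k + l + 1) s''"

text \<open>Hence "there is a halting execution" is the same as "the execution halts".\<close>

lemma exec_deterministic:
  "exec M p s k s' \<Longrightarrow> exec M p s l s'' \<Longrightarrow> l = k \<and> s'' = s'"
proof (induction arbitrary: l s'' rule: exec.induct)
  case (Seq p s k s' q l0 s0)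
  from Seq.prems show ?case by cases (use Seq.IH in blast)
next
  case (WhileTrue r a b p m k s' l0 s0)
  from WhileTrue.prems show ?case by cases (use WhileTrue in blast)+
qed (erule exec.cases; fastforce)+


section \<open>Input and output\<close>

text \<open>The input occupies the memory cells from address 0 on; everything else is initially 0.\<close>

definition init_state :: "nat list \<Rightarrow> ram_state" where
  "init_state inp = ((\<lambda>_. 0), (\<lambda>i. if i < length inp then int (inp ! i) else 0))"

text \<open>
  Encoding of a story: the vertices are numbered by their position in \<open>vs\<close>, and the input
  consists of \<open>n\<close>, \<open>W\<close>, the number of edges, the values of \<open>\<tau>\<close> in the order of \<open>vs\<close>, and the
  two endpoints of every edge. The numbering, the order of the edges and the order of the two
  endpoints are arbitrary; in particular they need not follow the path.
\<close>

definition encodes_story ::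
    "nat list \<Rightarrow> 'a list \<Rightarrow> 'a set \<Rightarrow> 'a set set \<Rightarrow> ('a \<Rightarrow> nat) \<Rightarrow> nat \<Rightarrow> bool" where
  "encodes_story inp vs V E \<tau> W \<longleftrightarrow>
     distinct vs \<and> set vs = V \<and>
     (\<exists>es :: (nat \<times> nat) list.
        (\<forall>(i, j) \<in> set es. i < length vs \<and> j < length vs) \<and>
        distinct (map (\<lambda>(i, j). {vs ! i, vs ! j}) es) \<and>
        set (map (\<lambda>(i, j). {vs ! i, vs ! j}) es) = E \<and>
        inp = [length vs, W, length es] @ map \<tau> vs @ concat (map (\<lambda>(i, j). [i, j]) es))"

text \<open>A straight-line drawing story is output as one pair of integer coordinates per vertex,
  in the order of \<open>vs\<close>, in consecutive memory cells starting at the address in register 0.\<close>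

definition outputs_story ::
    "ram_state \<Rightarrow> 'a list \<Rightarrow> 'a set \<Rightarrow> ('a \<Rightarrow> nat) \<Rightarrow> nat \<Rightarrow> (nat \<Rightarrow> 'a drawing) \<Rightarrow> bool" where
  "outputs_story s vs V \<tau> W \<Gamma> \<longleftrightarrow>
     (case s of (r, m) \<Rightarrow>
        0 \<le> r 0 \<and>
        (\<forall>t\<in>{1..card V + W - 1}. \<forall>i < length vs. vs ! i \<in> story_verts V \<tau> W t \<longrightarrow>
           point (\<Gamma> t) (vs ! i) =
             (of_int (m (nat (r 0) + 2 * i)), of_int (m (nat (r 0) + 2 * i + 1)))))"

end

theory Submission imports Defs begin

text \<open>
  Put the vertex $v$ into the bucket \<open>b = (\<tau> v - 1) div W\<close>. All vertices visible at one time lie in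
  two consecutive buckets. Draw $v$ at \<open>(k, b mod 2)\<close>, where $k$ is the number of vertices of the
  same bucket that precede $v$ on the path. Then two consecutive buckets lie on two different
  horizontal lines and are ordered from left to right by their position on the path, so the visible
  path edges appear from left to right in path order and do not cross. As a bucket has at most $W$
  vertices, a grid of width $W$ and height 2 would suffice.
\<close>

section \<open>The drawing\<close>

text \<open>A window of \<open>W\<close> times meets at most two blocks of \<open>W\<close>
  consecutive times, so among visible vertices the parity of the bucket determines the bucket.
  Buckets further apart reuse points, hence all disjointness claims are relative to one time. The
  running time is the other obstacle: edges come in arbitrary order and the machine cannot divide.
  One number per vertex, the sum of its neighbours' addresses, acts like an XOR-linked list: coming
  from one neighbour, subtraction yields the other. Which end of the path is found depends on the
  numbering, so the computed drawing may be that of the reversed path, and the program's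
  postcondition is a disjunction. Quotients by \<open>W\<close> are tabulated by counting, since
  repeated subtraction for each vertex could take quadratic time.\<close>

definition consecutive_pairs :: "'a list \<Rightarrow> 'a set set" where
  "consecutive_pairs p = {{p ! i, p ! Suc i} | i. Suc i < length p}"

lemma consecutive_pairs_eq_image:
  "consecutive_pairs p = (\<lambda>i. {p ! i, p ! Suc i}) ` {..<length p - 1}"
  unfolding consecutive_pairs_def by (auto simp: less_diff_conv)

text \<open>Needed because the program may walk the path from either end. One inclusion for all
  lists suffices, as reversal is an involution.\<close>

lemma consecutive_pairs_rev: "consecutive_pairs (rev p) = consecutive_pairs p"
proof -
  have sub: "consecutive_pairs (rev p) \<subseteq> consecutive_pairs p" for p :: "'a list"
  proof
    fix e assume "e \<in> consecutive_pairs (rev p)"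
    then obtain i where i: "Suc i < length p" "e = {rev p ! i, rev p ! Suc i}"
      unfolding consecutive_pairs_def by auto
    define j where "j = length p - Suc (Suc i)"
    have "e = {p ! j, p ! Suc j}" "Suc j < length p"
      using i by (auto simp: rev_nth j_def Suc_diff_Suc)
    then show "e \<in> consecutive_pairs p"
      unfolding consecutive_pairs_def by auto
  qed
  from sub[of p] sub[of "rev p"] show ?thesis by simp
qed

lemma consecutive_pairs_map: "consecutive_pairs (map f p) = (\<lambda>e. f ` e) ` consecutive_pairs p"
  unfolding consecutive_pairs_eq_image by (auto simp: image_image)

lemma inj_on_consecutive_pairs:
  assumes "distinct p"
  shows "inj_on (\<lambda>i. {p ! i, p ! Suc i}) {..<length p - 1}"
proof (rule inj_onI)
  fix i j assume "i \<in> {..<length p - 1}" "j \<in> {..<length p - 1}"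
    and "{p ! i, p ! Suc i} = {p ! j, p ! Suc j}"
  with assms show "i = j"
    by (auto simp: doubleton_eq_iff nth_eq_iff_index_eq)
qed

definition earlier_equal :: "(nat \<Rightarrow> 'b) \<Rightarrow> nat \<Rightarrow> nat" where
  "earlier_equal f k = card {i. i < k \<and> f i = f k}"

lemma earlier_equal_less:
  assumes "i < k" "f i = f k"
  shows "earlier_equal f i < earlier_equal f k"
proof -
  have "{j. j < i \<and> f j = f i} \<subset> {j. j < k \<and> f j = f k}"
    using assms by auto
  then show ?thesis
    unfolding earlier_equal_def by (intro psubset_card_mono) auto
qed

text \<open>Here $a, b, c, d$ stand for path vertices in this order, where $b$ and $c$ may coincide. The
  first segment is weakly to the left of the second one at every height.\<close>

lemma two_level_segments_meet:
  fixes x y :: "'a \<Rightarrow> real"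
  assumes level: "\<And>v. v \<in> {a,b,c,d} \<Longrightarrow> y v = 0 \<or> y v = 1"
    and mono: "y a = y b \<Longrightarrow> x a < x b" "y a = y c \<Longrightarrow> x a < x c" "y a = y d \<Longrightarrow> x a < x d"
       "y b = y c \<Longrightarrow> x b \<le> x c" "y b = y d \<Longrightarrow> x b < x d" "y c = y d \<Longrightarrow> x c < x d"
    and z: "z \<in> closed_segment (x a, y a) (x b, y b)" "z \<in> closed_segment (x c, y c) (x d, y d)"
  shows "z = (x b, y b) \<and> z = (x c, y c)"
proof -
  obtain s where s: "0 \<le> s" "s \<le> 1" "z = (1 - s) *\<^sub>R (x a, y a) + s *\<^sub>R (x b, y b)"
    using z(1) by (auto simp: in_segment)
  obtain t where t: "0 \<le> t" "t \<le> 1" "z = (1 - t) *\<^sub>R (x c, y c) + t *\<^sub>R (x d, y d)"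
    using z(2) by (auto simp: in_segment)
  have sx: "fst z = (1 - s) * x a + s * x b" and sy: "snd z = (1 - s) * y a + s * y b"
    using s by auto
  have tx: "fst z = (1 - t) * x c + t * x d" and ty: "snd z = (1 - t) * y c + t * y d"
    using t by auto
  have ab: "snd z = y a \<and> fst z \<le> x b" if "y a = y b"
  proof -
    have "0 \<le> (1 - s) * (x b - x a)" using s mono(1) that by simp
    then show ?thesis using sx sy that by (simp add: algebra_simps)
  qed
  have cd: "snd z = y c \<and> x c \<le> fst z" if "y c = y d"
  proof -
    have "0 \<le> t * (x d - x c)" using t mono(6) that by simp
    then show ?thesis using tx ty that by (simp add: algebra_simps)
  qed
  have ab': "z = (x a, y a) \<or> z = (x b, y b)" if "y a \<noteq> y b" "snd z = 0 \<or> snd z = 1"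
  proof -
    have "s = 0 \<or> s = 1" using that sy level[of a] level[of b] by auto
    then show ?thesis using s by auto
  qed
  have cd': "z = (x c, y c) \<or> z = (x d, y d)" if "y c \<noteq> y d" "snd z = 0 \<or> snd z = 1"
  proof -
    have "t = 0 \<or> t = 1" using that ty level[of c] level[of d] by auto
    then show ?thesis using t by auto
  qed
  \<comment> \<open>A horizontal segment puts \<open>z\<close> at height 0 or 1, where a slanted
    segment contains only its endpoints. Two slanted segments run in the same or in opposite
    vertical directions.\<close>
  consider "y a = y b" | "y a \<noteq> y b" "y c = y d" | "y a \<noteq> y b" "y c \<noteq> y d" "y a = y c"
    | "y a \<noteq> y b" "y c \<noteq> y d" "y a \<noteq> y c" by blast
  then show ?thesis
  proof cases
    case 1
    then have lz: "snd z = 0 \<or> snd z = 1" using ab level[of a] by auto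
    show ?thesis
    proof (cases "y c = y d")
      case True
      then show ?thesis using ab[OF 1] cd[OF True] mono(4) 1 by (auto simp: prod_eq_iff)
    next
      case False
      from cd'[OF False lz] show ?thesis
        using ab[OF 1] mono(4,5) 1 by (fastforce simp: prod_eq_iff)
    qed
  next
    case 2
    then have lz: "snd z = 0 \<or> snd z = 1" using cd level[of c] by auto
    from ab'[OF 2(1) lz] show ?thesis
      using cd[OF 2(2)] mono(2,4) by (fastforce simp: prod_eq_iff)
  next
    case 3
    then have bd: "y b = y d" using level[of a] level[of b] level[of c] level[of d] by auto
    \<comment> \<open>Equal heights force equal parameters. The horizontal gap is then a convex
      combination of two positive gaps and cannot vanish, so this case is contradictory.\<close>
    have "(s - t) * (y b - y a) = 0" using sy ty 3 bd by (simp add: algebra_simps)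
    then have "s = t" using 3 by auto
    then have "(1 - s) * (x c - x a) + s * (x d - x b) = 0"
      using sx tx by (simp add: algebra_simps)
    moreover have "(1 - s) * (x c - x a) \<ge> 0" "s * (x d - x b) \<ge> 0"
      using s mono(2,5) 3 bd by auto
    ultimately have "(1 - s) * (x c - x a) = 0" "s * (x d - x b) = 0" by linarith+
    then show ?thesis using mono(2,5) 3 bd by auto
  next
    case 4
    then have bd: "y b = y c" "y a = y d"
      using level[of a] level[of b] level[of c] level[of d] by auto
    \<comment> \<open>Now the parameters add up to 1. The gap \<open>x d - x a\<close> is positive,
      so its weight \<open>1 - s\<close> vanishes, which leaves only the common point of
      \<open>b\<close> and \<open>c\<close>.\<close>
    have "(s - (1 - t)) * (y b - y a) = 0" using sy ty bd by (simp add: algebra_simps)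
    then have st: "1 - t = s" using 4 by auto
    then have t': "t = 1 - s" by simp
    have "(1 - s) * (x d - x a) + s * (x c - x b) = 0"
      using sx tx unfolding t' by (simp add: algebra_simps)
    moreover have "(1 - s) * (x d - x a) \<ge> 0" "s * (x c - x b) \<ge> 0"
      using s mono(3,4) bd by auto
    ultimately have "(1 - s) * (x d - x a) = 0" "s * (x c - x b) = 0" by linarith+
    then have "s = 1" "x c = x b" using mono(3) bd by auto
    then show ?thesis using s bd by auto
  qed
qed

section \<open>Planarity and grid bounds of the drawing\<close>

text \<open>\<open>P\<close> is kept abstract and is constrained only on the path, because the final
  proof takes for it the coordinates found in the machine's memory.\<close>

locale drawn_path_story =
  fixes V :: "'a set" and \<tau> :: "'a \<Rightarrow> nat" and W :: nat and p :: "'a list"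
    and P :: "'a \<Rightarrow> real \<times> real"
  assumes distinct: "distinct p" and set_p: "set p = V"
    and \<tau>: "bij_betw \<tau> V {1..card V}" and W: "W > 0"
    and P_eq: "\<And>k. k < length p \<Longrightarrow>
      P (p ! k) = (real (earlier_equal (\<lambda>k. (\<tau> (p ! k) - 1) div W) k),
        real ((\<tau> (p ! k) - 1) div W mod 2))"
begin

definition bucket :: "nat \<Rightarrow> nat" where
  "bucket k = (\<tau> (p ! k) - 1) div W"

lemma P:
  "k < length p \<Longrightarrow> P (p ! k) = (real (earlier_equal bucket k), real (bucket k mod 2))"
  using P_eq unfolding bucket_def[abs_def] .


abbreviation "visible t \<equiv> {k. k < length p \<and> p ! k \<in> story_verts V \<tau> W t}"

text \<open>Independent of \<open>t\<close>, so drawings at different times agree trivially. The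
  convex hull gives the segment without choosing an order of the two endpoints.\<close>

definition drawing_at :: "nat \<Rightarrow> 'a drawing" where
  "drawing_at t = \<lparr>point = P, curve = \<lambda>e. convex hull (P ` e)\<rparr>"

lemma \<tau>_pos: "k < length p \<Longrightarrow> \<tau> (p ! k) \<ge> 1"
  using \<tau> set_p by (force simp: bij_betw_def)

lemma \<tau>_inj: "i < length p \<Longrightarrow> j < length p \<Longrightarrow> \<tau> (p ! i) = \<tau> (p ! j) \<Longrightarrow> i = j"
  using \<tau> set_p distinct by (metis bij_betw_imp_inj_on inj_onD nth_eq_iff_index_eq nth_mem)

text \<open>Shifted times in one bucket have equal quotients by \<open>W\<close>, hence distinct
  remainders. Counting \<open>k\<close> along with its predecessors makes the bound strict.\<close>

lemma earlier_equal_bucket_less: 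
  assumes k: "k < length p"
  shows "earlier_equal bucket k < W"
proof -
  let ?A = "{i. i < k \<and> bucket i = bucket k}"
  let ?g = "\<lambda>i. (\<tau> (p ! i) - 1) mod W"
  have inj: "inj_on ?g (insert k ?A)"
  proof (rule inj_onI)
    fix i j assume ij: "i \<in> insert k ?A" "j \<in> insert k ?A" "?g i = ?g j"
    then have "bucket i = bucket j" by auto
    then have "\<tau> (p ! i) - 1 = \<tau> (p ! j) - 1"
      using ij(3) unfolding bucket_def by (metis div_mult_mod_eq)
    then show "i = j"
      using \<tau>_pos[of i] \<tau>_pos[of j] \<tau>_inj[of i j] ij k by (auto simp: eq_diff_iff)
  qed
  have "card (insert k ?A) = card (?g ` insert k ?A)"
    using card_image[OF inj] by simp
  also have "\<dots> \<le> card {..<W}"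
    by (rule card_mono) (use W in auto)
  finally show ?thesis by (simp add: earlier_equal_def)
qed

text \<open>Times visible together differ by less than \<open>W\<close>, and adding \<open>W\<close>
  raises the quotient by exactly one.\<close>

lemma bucket_le_Suc_if_visible:
  assumes "i \<in> visible t" "j \<in> visible t"
  shows "bucket i \<le> Suc (bucket j)"
proof -
  have "\<tau> (p ! i) - 1 \<le> (\<tau> (p ! j) - 1) + W"
    using assms by (auto simp: story_verts_def)
  then have "bucket i \<le> ((\<tau> (p ! j) - 1) + W) div W"
    unfolding bucket_def by (rule div_le_mono)
  also have "\<dots> = Suc (bucket j)" using W by (simp add: bucket_def)
  finally show ?thesis .
qed

lemma bucket_eq_if_visible:
  assumes "i \<in> visible t" "j \<in> visible t" "bucket i mod 2 = bucket j mod 2"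
  shows "bucket i = bucket j"
  using bucket_le_Suc_if_visible[OF assms(1,2)] bucket_le_Suc_if_visible[OF assms(2,1)] assms(3)
  by presburger

lemma fst_less_if_visible:
  assumes "i \<in> visible t" "j \<in> visible t" "i < j" "snd (P (p ! i)) = snd (P (p ! j))"
  shows "fst (P (p ! i)) < fst (P (p ! j))"
proof -
  have "bucket i mod 2 = bucket j mod 2" using assms P by auto
  then have "bucket i = bucket j" using bucket_eq_if_visible assms by blast
  then have "earlier_equal bucket i < earlier_equal bucket j"
    using earlier_equal_less assms by blast
  then show ?thesis using P assms by auto
qed

lemma level: "k < length p \<Longrightarrow> snd (P (p ! k)) = 0 \<or> snd (P (p ! k)) = 1"
  using P[of k] mod_less_divisor[of 2 "bucket k"] by (auto simp del: mod_less_divisor)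

lemma P_eq_iff_if_visible:
  assumes "i \<in> visible t" "j \<in> visible t"
  shows "P (p ! i) = P (p ! j) \<longleftrightarrow> i = j"
  using fst_less_if_visible[OF assms] fst_less_if_visible[OF assms(2,1)]
  by (metis linorder_neq_iff less_irrefl)

lemma visible_vertexE:
  assumes "v \<in> story_verts V \<tau> W t"
  obtains k where "k \<in> visible t" "v = p ! k"
proof -
  have "v \<in> set p" using assms set_p by (simp add: story_verts_def)
  then obtain k where "k < length p" "p ! k = v" by (auto simp: in_set_conv_nth)
  then show thesis using assms by (intro that[of k]) auto
qed

lemma visible_edgeE:
  assumes "e \<in> story_edges V (consecutive_pairs p) \<tau> W t"
  obtains i where "i \<in> visible t" "Suc i \<in> visible t" "e = {p ! i, p ! Suc i}"
  using assms by (auto simp: story_edges_def consecutive_pairs_def)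

lemma curve_drawing_at [simp]: 
  "curve (drawing_at t) {u, v} = closed_segment (P u) (P v)"
  by (simp add: drawing_at_def segment_convex_hull)

lemma point_drawing_at [simp]: "point (drawing_at t) = P"
  by (simp add: drawing_at_def)

text \<open>On a horizontal segment the vertex would need a path position strictly between
  \<open>i\<close> and \<open>Suc i\<close>. A slanted segment meets the two levels only in its
  endpoints, which belong to other vertices.\<close>

lemma vertex_not_on_segment:
  assumes "k \<in> visible t" "i \<in> visible t" "Suc i \<in> visible t" "k \<noteq> i" "k \<noteq> Suc i"
  shows "P (p ! k) \<notin> closed_segment (P (p ! i)) (P (p ! Suc i))"
proof
  let ?P = "\<lambda>i. P (p ! i)"
  assume "?P k \<in> closed_segment (?P i) (?P (Suc i))"
  then obtain s where s: "0 \<le> s" "s \<le> 1" "?P k = (1 - s) *\<^sub>R ?P i + s *\<^sub>R ?P (Suc i)"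
    by (auto simp: in_segment)
  have sx: "fst (?P k) = (1 - s) * fst (?P i) + s * fst (?P (Suc i))"
    and sy: "snd (?P k) = (1 - s) * snd (?P i) + s * snd (?P (Suc i))"
    using s by auto
  show False
  proof (cases "snd (?P i) = snd (?P (Suc i))")
    case True
    then have y: "snd (?P k) = snd (?P i)" using sy by (simp add: algebra_simps)
    have lt: "fst (?P i) < fst (?P (Suc i))"
      using fst_less_if_visible assms True by auto
    have "0 \<le> s * (fst (?P (Suc i)) - fst (?P i))" "0 \<le> (1 - s) * (fst (?P (Suc i)) - fst (?P i))"
      using s lt by auto
    then have "fst (?P i) \<le> fst (?P k)" "fst (?P k) \<le> fst (?P (Suc i))"
      using sx by (auto simp: algebra_simps)
    moreover have "k < i \<or> Suc i < k" using assms by linarith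
    ultimately show False
    proof (elim disjE)
      assume "k < i"
      then show False
        using fst_less_if_visible[OF assms(1,2)] y \<open>fst (?P i) \<le> fst (?P k)\<close> by simp
    next
      assume "Suc i < k"
      then show False
        using fst_less_if_visible[OF assms(3,1)] y True \<open>fst (?P k) \<le> fst (?P (Suc i))\<close> by simp
    qed
  next
    case False
    have "s = 0 \<or> s = 1"
      using False sy level[of i] level[of "Suc i"] level[of k] assms by auto
    then have "?P k = ?P i \<or> ?P k = ?P (Suc i)" using s by auto
    then show False using P_eq_iff_if_visible assms by blast
  qed
qed

lemma segments_meet:
  assumes "i \<in> visible t" "Suc i \<in> visible t" "j \<in> visible t" "Suc j \<in> visible t" "i < j"
    and "z \<in> closed_segment (P (p ! i)) (P (p ! Suc i))"
    and "z \<in> closed_segment (P (p ! j)) (P (p ! Suc j))"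
  shows "j = Suc i \<and> z = P (p ! j)"
proof -
  have len: "i < length p" "Suc i < length p" "j < length p" "Suc j < length p" using assms by auto
  let ?x = "\<lambda>i. fst (P (p ! i))" and ?y = "\<lambda>i. snd (P (p ! i))"
  have "z = (?x (Suc i), ?y (Suc i)) \<and> z = (?x j, ?y j)"
  proof (rule two_level_segments_meet[where a = i and b = "Suc i" and c = j and d = "Suc j" 
        and x = ?x and y = ?y])
    show "?x (Suc i) \<le> ?x j" if "?y (Suc i) = ?y j"
    proof (cases "j = Suc i")
      case False
      then show ?thesis using fst_less_if_visible[OF assms(2,3)] assms(5) that by simp
    qed simp
    show "?y v = 0 \<or> ?y v = 1" if "v \<in> {i, Suc i, j, Suc j}" for v
      using that level len by blast
    show "?x i < ?x (Suc i)" if "?y i = ?y (Suc i)"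
      using fst_less_if_visible[OF assms(1,2) _ that] by simp
    show "?x i < ?x j" if "?y i = ?y j"
      using fst_less_if_visible[OF assms(1,3) _ that] assms(5) by simp
    show "?x i < ?x (Suc j)" if "?y i = ?y (Suc j)"
      using fst_less_if_visible[OF assms(1,4) _ that] assms(5) by simp
    show "?x (Suc i) < ?x (Suc j)" if "?y (Suc i) = ?y (Suc j)"
      using fst_less_if_visible[OF assms(2,4) _ that] assms(5) by simp
    show "?x j < ?x (Suc j)" if "?y j = ?y (Suc j)"
      using fst_less_if_visible[OF assms(3,4) _ that] by simp
  qed (use assms(6,7) in simp_all)
  then have z: "z = P (p ! Suc i)" "z = P (p ! j)" by auto
  then show ?thesis using P_eq_iff_if_visible[of "Suc i" t j] assms by auto
qed

lemma planar_drawing_at: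
  "planar_drawing (story_verts V \<tau> W t) (story_edges V (consecutive_pairs p) \<tau> W t) (drawing_at t)"
  unfolding planar_drawing_def
proof (intro conjI ballI impI)
  fix e v assume e: "e \<in> story_edges V (consecutive_pairs p) \<tau> W t"
    and v: "v \<in> story_verts V \<tau> W t" "v \<notin> e"
  obtain i where i: "i \<in> visible t" "Suc i \<in> visible t" "e = {p ! i, p ! Suc i}"
    by (rule visible_edgeE[OF e])
  obtain k where k: "k \<in> visible t" "v = p ! k"
    by (rule visible_vertexE[OF v(1)])
  from i k v(2) show "point (drawing_at t) v \<notin> curve (drawing_at t) e"
    using vertex_not_on_segment[of k t i] by auto
next
  fix e f assume e: "e \<in> story_edges V (consecutive_pairs p) \<tau> W t"
    and f: "f \<in> story_edges V (consecutive_pairs p) \<tau> W t" and "e \<noteq> f"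
  obtain i where i: "i \<in> visible t" "Suc i \<in> visible t" "e = {p ! i, p ! Suc i}"
    by (rule visible_edgeE[OF e])
  obtain j where j: "j \<in> visible t" "Suc j \<in> visible t" "f = {p ! j, p ! Suc j}"
    by (rule visible_edgeE[OF f])
  show "curve (drawing_at t) e \<inter> curve (drawing_at t) f \<subseteq> point (drawing_at t) ` (e \<inter> f)"
  proof
    fix z assume "z \<in> curve (drawing_at t) e \<inter> curve (drawing_at t) f"
    then have z: "z \<in> closed_segment (P (p ! i)) (P (p ! Suc i))"
      "z \<in> closed_segment (P (p ! j)) (P (p ! Suc j))" using i j by auto
    from \<open>e \<noteq> f\<close> i j have "i < j \<or> j < i" by (cases i j rule: linorder_cases) auto
    then have "(j = Suc i \<and> z = P (p ! j)) \<or> (i = Suc j \<and> z = P (p ! i))"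
      using segments_meet i j z by blast
    then show "z \<in> point (drawing_at t) ` (e \<inter> f)" using i j by auto
  qed
qed

lemma is_drawing_at:
  "is_drawing (story_verts V \<tau> W t) (story_edges V (consecutive_pairs p) \<tau> W t) (drawing_at t)"
  unfolding is_drawing_def
proof (intro conjI ballI)
  show "inj_on (point (drawing_at t)) (story_verts V \<tau> W t)"
  proof (rule inj_onI)
    fix u v assume uv: "u \<in> story_verts V \<tau> W t" "v \<in> story_verts V \<tau> W t"
      and eq: "point (drawing_at t) u = point (drawing_at t) v"
    obtain i where i: "i \<in> visible t" "u = p ! i" by (rule visible_vertexE[OF uv(1)])
    obtain j where j: "j \<in> visible t" "v = p ! j" by (rule visible_vertexE[OF uv(2)])
    show "u = v" using P_eq_iff_if_visible[OF i(1) j(1)] eq i j by simp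
  qed
  fix e assume "e \<in> story_edges V (consecutive_pairs p) \<tau> W t"
  then obtain i where i: "i \<in> visible t" "Suc i \<in> visible t" "e = {p ! i, p ! Suc i}"
    by (rule visible_edgeE)
  then have "P (p ! i) \<noteq> P (p ! Suc i)" using P_eq_iff_if_visible[of i t "Suc i"] by auto
  then show "\<exists>g. arc g \<and> path_image g = curve (drawing_at t) e \<and>
                {pathstart g, pathfinish g} = point (drawing_at t) ` e"
    using i by (intro exI[of _ "linepath (P (p ! i)) (P (p ! Suc i))"]) auto
qed

lemma P_in_grid:
  assumes "k < length p"
  shows "\<exists>x\<in>{0..2 * int W - 1}. \<exists>y\<in>{0..2 * int W - 1}. P (p ! k) = (of_int x, of_int y)"
proof (intro bexI)
  show "P (p ! k) = (of_int (int (earlier_equal bucket k)), of_int (int (bucket k mod 2)))"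
    using P[OF assms] by simp
  show "int (earlier_equal bucket k) \<in> {0..2 * int W - 1}"
    using earlier_equal_bucket_less[OF assms] by auto
  have "bucket k mod 2 < 2" by simp
  then show "int (bucket k mod 2) \<in> {0..2 * int W - 1}" using W by (simp del: mod_less_divisor)
qed

lemma story_on_grid: 
  "story_on_grid V (consecutive_pairs p) \<tau> W drawing_at (2 * W) (2 * W)"
  unfolding story_on_grid_def
proof (rule exI[of _ 0], rule exI[of _ "2 * int W - 1"], rule exI[of _ 0], 
    rule exI[of _ "2 * int W - 1"], intro conjI ballI)
  fix t v assume "v \<in> story_verts V \<tau> W t"
  then obtain k where "k \<in> visible t" "v = p ! k" by (rule visible_vertexE)
  then show "\<exists>x\<in>{0..2 * int W - 1}. \<exists>y\<in>{0..2 * int W - 1}. 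
      point (drawing_at t) v = (of_int x, of_int y)"
    using P_in_grid[of k] by auto
next
  fix t e assume "e \<in> story_edges V (consecutive_pairs p) \<tau> W t"
  then obtain i where i: "i \<in> visible t" "Suc i \<in> visible t" "e = {p ! i, p ! Suc i}"
    by (rule visible_edgeE)
  let ?box = "{of_int 0..of_int (2 * int W - 1)} \<times> {of_int 0..of_int (2 * int W - 1)} 
    :: (real \<times> real) set"
  have in_box: "P (p ! k) \<in> ?box" if k: "k < length p" for k
  proof -
    obtain x y where "x \<in> {0..2 * int W - 1}" "y \<in> {0..2 * int W - 1}"
      "P (p ! k) = (of_int x, of_int y)" using P_in_grid[OF k] by blast
    then show ?thesis by (simp only: mem_Times_iff fst_conv snd_conv atLeastAtMost_iff of_int_le_iff)
  qed
  have "closed_segment (P (p ! i)) (P (p ! Suc i)) \<subseteq> ?box"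
    by (rule closed_segment_subset) (use in_box i in \<open>auto simp del: of_int_0 intro!: convex_Times convex_closed_interval\<close>)
  then show "curve (drawing_at t) e \<subseteq> ?box" using i by simp
qed auto

lemma drawing_story: "drawing_story V (consecutive_pairs p) \<tau> W drawing_at"
  unfolding drawing_story_def using is_drawing_at by (auto simp: drawing_at_def)

lemma planar_story: "planar_story V (consecutive_pairs p) \<tau> W drawing_at"
  unfolding planar_story_def using planar_drawing_at by auto

lemma straight_line_story: "straight_line_story V (consecutive_pairs p) \<tau> W drawing_at"
  unfolding straight_line_story_def straight_line_drawing_def by simp

end

section \<open>Running times\<close>

text \<open>\<open>K\<close> is only an upper bound, since the branches of a test differ in length.
  The existence of an execution also certifies that the word bound is respected.\<close>

definition runs :: "nat \<Rightarrow> prog \<Rightarrow> ram_state \<Rightarrow> nat \<Rightarrow> (ram_state \<Rightarrow> bool) \<Rightarrow> bool" where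
  "runs M p s K Q \<longleftrightarrow> (\<exists>k s'. exec M p s k s' \<and> k \<le> K \<and> Q s')"

lemma runs_Seq:
  assumes "runs M p s K R" "\<And>s'. R s' \<Longrightarrow> runs M q s' L Q"
  shows "runs M (Seq p q) s (K + L) Q"
  using assms unfolding runs_def by (meson exec.Seq add_mono)

lemma runs_step: "exec M p s 1 s' \<Longrightarrow> Q s' \<Longrightarrow> runs M p s 1 Q"
  unfolding runs_def by blast

lemma runs_mono:
  assumes "runs M p s K R" "K \<le> L" "\<And>s'. R s' \<Longrightarrow> Q s'"
  shows "runs M p s L Q"
  using assms unfolding runs_def by (meson order_trans)

text \<open>\<open>I\<close> is indexed by the number of completed iterations. Each iteration pays
  one unit for its test, and the final failing test accounts for the last 1.\<close>

lemma runs_WhileLess: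
  assumes guard: "\<And>j r m. j \<le> N \<Longrightarrow> I j (r, m) \<Longrightarrow> opval r a < opval r b \<longleftrightarrow> j < N"
    and body: "\<And>j s. j < N \<Longrightarrow> I j s \<Longrightarrow> runs M p s K (I (Suc j))"
    and init: "I 0 s"
  shows "runs M (WhileLess a b p) s (N * (K + 1) + 1) (I N)"
proof -
  have "runs M (WhileLess a b p) s ((N - j) * (K + 1) + 1) (I N)" if "j \<le> N" "I j s" for j s
    using that
  proof (induction "N - j" arbitrary: j s)
    case 0
    obtain r m where s: "s = (r, m)" by fastforce
    with 0 have "\<not> opval r a < opval r b" using guard[of j r m] by simp
    then have "exec M (WhileLess a b p) s 1 s" unfolding s by (rule WhileFalse)
    then show ?case using 0 unfolding runs_def by (intro exI[of _ 1] exI[of _ s]) simp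
  next
    case (Suc d)
    obtain r m where s: "s = (r, m)" by fastforce
    from Suc have "j < N" by simp
    then have lt: "opval r a < opval r b" using guard[of j r m] Suc s by simp
    obtain k s' where k: "exec M p s k s'" "k \<le> K" "I (Suc j) s'"
      using body[OF \<open>j < N\<close> Suc.prems(2)] by (auto simp: runs_def)
    have "runs M (WhileLess a b p) s' ((N - Suc j) * (K + 1) + 1) (I N)"
      by (rule Suc.hyps(1)) (use Suc.hyps(2) \<open>j < N\<close> k in auto)
    then obtain l s'' where l: "exec M (WhileLess a b p) s' l s''" 
      "l \<le> (N - Suc j) * (K + 1) + 1" "I N s''"
      unfolding runs_def by blast
    have "exec M (WhileLess a b p) s (k + l + 1) s''"
      using WhileTrue[OF lt] k l s by blast
    moreover have "k + l + 1 \<le> (N - j) * (K + 1) + 1"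
    proof -
      have "N - j = Suc (N - Suc j)" using \<open>j < N\<close> by simp
      then have "(N - j) * (K + 1) = K + 1 + (N - Suc j) * (K + 1)" by simp
      then show ?thesis using k l by linarith
    qed
    ultimately show ?case using l unfolding runs_def by blast
  qed
  from this[of 0 s] init show ?thesis by simp
qed

text \<open>Loops are not handled here; they get the junk values \<open>False\<close> and \<open>0\<close>.\<close>

fun wp :: "nat \<Rightarrow> prog \<Rightarrow> (ram_state \<Rightarrow> bool) \<Rightarrow> ram_state \<Rightarrow> bool" where
  "wp M Skip Q s = Q s"
| "wp M (Move d a) Q (r, m) = (\<bar>opval r a\<bar> \<le> int M \<and> Q (r(d := opval r a), m))"
| "wp M (Add d a b) Q (r, m) =
    (\<bar>opval r a + opval r b\<bar> \<le> int M \<and> Q (r(d := opval r a + opval r b), m))"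
| "wp M (Sub d a b) Q (r, m) =
    (\<bar>opval r a - opval r b\<bar> \<le> int M \<and> Q (r(d := opval r a - opval r b), m))"
| "wp M (Load d a) Q (r, m) =
    (0 \<le> opval r a \<and> opval r a \<le> int M \<and> Q (r(d := m (nat (opval r a))), m))"
| "wp M (Store a b) Q (r, m) =
    (0 \<le> opval r a \<and> opval r a \<le> int M \<and> \<bar>opval r b\<bar> \<le> int M \<and>
     Q (r, m(nat (opval r a) := opval r b)))"
| "wp M (Seq p q) Q s = wp M p (wp M q Q) s"
| "wp M (IfLess a b p q) Q (r, m) =
    (if opval r a < opval r b then wp M p Q (r, m) else wp M q Q (r, m))"
| "wp M (WhileLess a b p) Q s = False"

fun cost :: "prog \<Rightarrow> nat" where
  "cost (Seq p q) = cost p + cost q"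
| "cost (IfLess a b p q) = max (cost p) (cost q) + 1"
| "cost (WhileLess a b p) = 0"
| "cost _ = 1"

lemma runs_if_wp: "wp M p Q s \<Longrightarrow> runs M p s (cost p) Q"
proof (induction p arbitrary: Q s)
  case (Seq p q)
  have "runs M p s (cost p) (wp M q Q)" using Seq by simp
  then show ?case using Seq.IH(2) by (auto intro: runs_Seq)
next
  case (IfLess a b p q)
  obtain r m where s: "s = (r, m)" by fastforce
  show ?case
  proof (cases "opval r a < opval r b")
    case True
    then have "wp M p Q (r, m)" using IfLess.prems s by simp
    then have "runs M p (r, m) (cost p) Q" by (rule IfLess.IH(1))
    then obtain k s' where "exec M p (r, m) k s'" "k \<le> cost p" "Q s'"
      by (auto simp: runs_def)
    then show ?thesis using IfTrue[OF True, of M p m k s' q] s unfolding runs_def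
      by (intro exI[of _ "k+1"] exI[of _ s']) auto
  next
    case False
    then have "wp M q Q (r, m)" using IfLess.prems s by simp
    then have "runs M q (r, m) (cost q) Q" by (rule IfLess.IH(2))
    then obtain k s' where "exec M q (r, m) k s'" "k \<le> cost q" "Q s'"
      by (auto simp: runs_def)
    then show ?thesis using IfFalse[OF False, of M q m k s' p] s unfolding runs_def
      by (intro exI[of _ "k+1"] exI[of _ s']) auto
  qed
next
  case Skip
  then show ?case using runs_step[OF exec.Skip] by simp
next
  case (Move d a)
  then show ?case by (cases s) (simp add: runs_step[OF exec.Move, unfolded One_nat_def])
next
  case (Add d a b)
  then show ?case by (cases s) (simp add: runs_step[OF exec.Add, unfolded One_nat_def])
next
  case (Sub d a b)
  then show ?case by (cases s) (simp add: runs_step[OF exec.Sub, unfolded One_nat_def])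
next
  case (Load d a)
  then show ?case by (cases s) (simp add: runs_step[OF exec.Load, unfolded One_nat_def])
next
  case (Store a b)
  then show ?case by (cases s) (simp add: runs_step[OF exec.Store, unfolded One_nat_def])
qed simp

text \<open>The closing \<open>Skip\<close> costs a step, so a block of \<open>k\<close> simple
  instructions costs \<open>k + 1\<close>. This gives the 3 and 5 in the bounds of the
  initialisation blocks.\<close>

fun block :: "prog list \<Rightarrow> prog" where
  "block [] = Skip"
| "block (p # ps) = Seq p (block ps)"

section \<open>The program\<close>

text \<open>
  Memory layout, with $n$ in register 1 and $W$ in register 2; $u$ is a vertex number, $x < n$ a
  time minus one and $b < n$ a bucket:
  \<^item> \<open>3 n + 1 + u\<close> (base in register 3): sum of the addresses \<open>3 n + 1 + v\<close> of the neighbours $v$ of $u$;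
  \<^item> \<open>4 n + 1 + x\<close> (base in register 4): \<open>x div W\<close>;
  \<^item> \<open>5 n + 1 + x\<close> (base in register 5): \<open>x div W mod 2\<close>;
  \<^item> \<open>6 n + 1 + b\<close> (base in register 6): number of vertices of bucket $b$ placed so far;
  \<^item> \<open>7 n + 1 + 2 u\<close> and \<open>7 n + 2 + 2 u\<close> (base in register 0): coordinates of $u$.

  Since \<open>v < n \<le> 3 n\<close>, an end vertex is recognised by an address sum below \<open>2 (3 n + 1)\<close>, and the
  successor of a vertex on the path is its address sum minus the address of its predecessor.
\<close>

definition setup_bases :: prog where
  "setup_bases = block [
     Load 1 (Imm 0),
     Load 2 (Imm 1),
     Add 3 (Reg 1) (Reg 1),
     Add 3 (Reg 3) (Reg 1),
     Add 3 (Reg 3) (Imm 1),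
     Add 4 (Reg 3) (Reg 1),
     Add 5 (Reg 4) (Reg 1),
     Add 6 (Reg 5) (Reg 1),
     Add 0 (Reg 6) (Reg 1),
     Add 7 (Reg 1) (Imm 3)]"

text \<open>Register 7 runs through the edge list, which starts at \<open>n + 3\<close> and, with
  \<open>n - 1\<close> edges, ends just before \<open>3 n + 1\<close>. The table base in register 3
  therefore serves as loop bound.\<close>

definition add_edge :: prog where
  "add_edge = block [
     Load 8 (Reg 7),
     Add 7 (Reg 7) (Imm 1),
     Load 9 (Reg 7),
     Add 7 (Reg 7) (Imm 1),
     Add 8 (Reg 8) (Reg 3),
     Add 9 (Reg 9) (Reg 3),
     Load 10 (Reg 8),
     Add 10 (Reg 10) (Reg 9),
     Store (Reg 8) (Reg 10),
     Load 10 (Reg 9),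
     Add 10 (Reg 10) (Reg 8),
     Store (Reg 9) (Reg 10)]"

definition test_endpoint :: prog where
  "test_endpoint = block [
     Load 8 (Reg 7),
     IfLess (Reg 8) (Reg 10) (Move 9 (Reg 7)) Skip,
     Add 7 (Reg 7) (Imm 1)]"

text \<open>Registers 10, 11 and 12 hold quotient, remainder and parity of the current time, so each
  table entry takes constant time.\<close>

definition next_time :: prog where
  "next_time = block [
     Add 8 (Reg 4) (Reg 7),
     Store (Reg 8) (Reg 10),
     Add 8 (Reg 8) (Reg 1),
     Store (Reg 8) (Reg 12),
     Add 7 (Reg 7) (Imm 1),
     Add 11 (Reg 11) (Imm 1),
     IfLess (Reg 11) (Reg 2) Skip
       (block [Move 11 (Imm 0), Add 10 (Reg 10) (Imm 1), Sub 12 (Imm 1) (Reg 12)])]"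

definition fetch_vertex :: prog where
  "fetch_vertex = block [
     Load 10 (Reg 9),
     Sub 13 (Reg 9) (Reg 3),
     Add 11 (Reg 13) (Imm 3),
     Load 11 (Reg 11),
     Sub 11 (Reg 11) (Imm 1),
     Add 11 (Reg 11) (Reg 4),
     Load 12 (Reg 11),
     Add 11 (Reg 11) (Reg 1),
     Load 14 (Reg 11),
     Add 12 (Reg 12) (Reg 6),
     Load 15 (Reg 12)]"

text \<open>Register 8 holds the predecessor's address, or 0 at the first vertex, so the subtraction
  from register 10 gives the successor's address.\<close>

definition write_vertex :: prog where
  "write_vertex = block [
     Add 13 (Reg 13) (Reg 13),
     Add 13 (Reg 13) (Reg 0),
     Store (Reg 13) (Reg 15),
     Add 13 (Reg 13) (Imm 1),
     Store (Reg 13) (Reg 14),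
     Add 15 (Reg 15) (Imm 1),
     Store (Reg 12) (Reg 15),
     Sub 10 (Reg 10) (Reg 8),
     Move 8 (Reg 9),
     Move 9 (Reg 10),
     Add 7 (Reg 7) (Imm 1)]"

definition place_vertex :: prog where
  "place_vertex = Seq fetch_vertex write_vertex"

definition path_story_prog :: prog where
  "path_story_prog = 
     Seq setup_bases (Seq (WhileLess (Reg 7) (Reg 3) add_edge)
     (Seq (block [Move 7 (Reg 3), Add 10 (Reg 3) (Reg 3)])
     (Seq (WhileLess (Reg 7) (Reg 4) test_endpoint)
     (Seq (block [Move 7 (Imm 0), Move 10 (Imm 0), Move 11 (Imm 0), Move 12 (Imm 0)])
     (Seq (WhileLess (Reg 7) (Reg 1) next_time)
     (Seq (block [Move 7 (Imm 0), Move 8 (Imm 0)])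
     (WhileLess (Reg 7) (Reg 1) place_vertex)))))))"


section \<open>Correctness of the program\<close>

definition bases :: "nat \<Rightarrow> nat \<Rightarrow> (nat \<Rightarrow> int) \<Rightarrow> bool" where
  "bases n W r \<longleftrightarrow> r 0 = 7 * int n + 1 \<and> r 1 = int n \<and> r 2 = int W \<and> r 3 = 3 * int n + 1 \<and>
     r 4 = 4 * int n + 1 \<and> r 5 = 5 * int n + 1 \<and> r 6 = 6 * int n + 1"

section \<open>Sums over the neighbours on a path\<close>

definition nbr_sum :: "nat \<Rightarrow> (nat \<times> nat) list \<Rightarrow> nat \<Rightarrow> nat" where
  "nbr_sum B es i = (\<Sum>(u, v)\<leftarrow>es. (if u = i then B + v else 0) + (if v = i then B + u else 0))"

text \<open>The contribution of an edge as a set; the order in which the input lists its endpoints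
  disappears.\<close>

definition nbrs :: "nat \<Rightarrow> nat \<Rightarrow> nat set \<Rightarrow> nat" where
  "nbrs B i e = (if i \<in> e then \<Sum>x\<in>e - {i}. B + x else 0)"

lemma nbrs_pair: "u \<noteq> v \<Longrightarrow>
  nbrs B i {u, v} = (if u = i then B + v else 0) + (if v = i then B + u else 0)"
  by (auto simp: nbrs_def insert_Diff_if)

text \<open>As the edges are distinct, the sum over the input list is a sum over the edge set and
  can be reindexed by path positions. Only positions \<open>l\<close> and \<open>l - 1\<close>
  contribute.\<close>

lemma nbr_sum_path:
  assumes ne: "\<And>u v. (u, v) \<in> set es \<Longrightarrow> u \<noteq> v"
    and d: "distinct (map (\<lambda>(u, v). {u, v}) es)"
    and s: "set (map (\<lambda>(u, v). {u, v}) es) = consecutive_pairs q"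
    and q: "distinct q" "l < length q"
  shows "nbr_sum B es (q ! l) = (if Suc l < length q then B + q ! Suc l else 0) +
           (if 0 < l then B + q ! (l - 1) else 0)"
proof -
  let ?i = "q ! l" and ?n = "length q - 1"
  have "nbr_sum B es ?i = sum_list (map (nbrs B ?i) (map (\<lambda>(u, v). {u, v}) es))"
    unfolding nbr_sum_def map_map
    by (intro arg_cong[of _ _ sum_list] map_cong refl) (auto simp: nbrs_pair dest: ne)
  also have "\<dots> = sum (nbrs B ?i) (consecutive_pairs q)"
    unfolding sum_list_distinct_conv_sum_set[OF d] s ..
  also have "\<dots> = (\<Sum>k<?n. nbrs B ?i {q ! k, q ! Suc k})"
    unfolding consecutive_pairs_eq_image
    by (subst sum.reindex[OF inj_on_consecutive_pairs[OF q(1)]]) simp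
  also have "\<dots> = (\<Sum>k<?n. (if k = l then B + q ! Suc k else 0) + (if Suc k = l then B + q ! k else 0))"
    using q by (intro sum.cong refl, subst nbrs_pair) (auto simp: nth_eq_iff_index_eq)
  \<comment> \<open>\<open>Suc k = l\<close> becomes \<open>k = l - 1\<close> to suit
    \<open>sum.delta\<close>; the inner test guards against truncated subtraction at
    \<open>l = 0\<close>.\<close>
  also have "\<dots> = (\<Sum>k<?n. if k = l then B + q ! Suc k else 0) + 
      (\<Sum>k<?n. if k = l - 1 then if 0 < l then B + q ! k else 0 else 0)"
    unfolding sum.distrib by (intro arg_cong2[of _ _ _ _ "(+)"] sum.cong) auto
  also have "\<dots> = (if Suc l < length q then B + q ! Suc l else 0) +
           (if 0 < l then B + q ! (l - 1) else 0)"
    using q by (auto simp: sum.delta)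
  finally show ?thesis .
qed

text \<open>Keeps the intermediate values of the edge loop within the word bound, once the final
  sums are bounded.\<close>

lemma nbr_sum_take_le: "nbr_sum B (take j es) i \<le> nbr_sum B es i"
proof -
  have "nbr_sum B es i = nbr_sum B (take j es) i + nbr_sum B (drop j es) i"
    unfolding nbr_sum_def sum_list_append[symmetric] map_append[symmetric] by simp
  then show ?thesis by simp
qed

lemma nbr_sum_take_Suc:
  assumes "j < length es" "es ! j = (u, v)"
  shows "nbr_sum B (take (Suc j) es) i = nbr_sum B (take j es) i + 
     ((if u = i then B + v else 0) + (if v = i then B + u else 0))"
  using assms by (simp add: nbr_sum_def take_Suc_conv_app_nth)

section \<open>Invariants of the program phases\<close>

text \<open>Here \<open>t\<close> is the time minus one and \<open>q\<close> lists the path by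
  vertex numbers; reversing \<open>q\<close> preserves all assumptions. The factor 20 is generous:
  addresses reach at most \<open>9 n\<close> and neighbour sums at most \<open>8 n\<close>.\<close>

locale path_input =
  fixes n W M :: nat and t :: "nat \<Rightarrow> nat" and es :: "(nat \<times> nat) list" and q :: "nat list"
  assumes n: "n > 0" and W: "W > 0" and M: "20 * (n + W) \<le> M"
    and q: "distinct q" "set q = {..<n}"
    and es_less: "\<And>u v. (u, v) \<in> set es \<Longrightarrow> u < n \<and> v < n"
    and es_distinct: "distinct (map (\<lambda>(u, v). {u, v}) es)"
    and es_q: "set (map (\<lambda>(u, v). {u, v}) es) = consecutive_pairs q"
    and t: "\<And>u. u < n \<Longrightarrow> t u < n"
begin

abbreviation "B \<equiv> 3 * n + 1"

lemma length_q: "length q = n"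
  using distinct_card[OF q(1)] q(2) by simp

lemma q_less: "k < n \<Longrightarrow> q ! k < n"
  using nth_mem[of k q] q length_q by auto

lemma length_es: "length es = n - 1"
proof -
  have "length es = card (consecutive_pairs q)"
    using distinct_card[OF es_distinct] es_q by simp
  also have "\<dots> = n - 1"
    unfolding consecutive_pairs_eq_image 
    using card_image[OF inj_on_consecutive_pairs[OF q(1)]] by (simp add: length_q)
  finally show ?thesis .
qed

lemma es_neq: 
  assumes "(u, v) \<in> set es" 
  shows "u \<noteq> v"
proof -
  have "{u, v} \<in> consecutive_pairs q" using assms es_q by force
  then obtain k where "Suc k < length q" "{u, v} = {q ! k, q ! Suc k}"
    by (auto simp: consecutive_pairs_def)
  moreover from this have "q ! k \<noteq> q ! Suc k" using q by (simp add: nth_eq_iff_index_eq)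
  ultimately show ?thesis by auto
qed

lemma nbr_sum_q:
  "l < n \<Longrightarrow> nbr_sum B es (q ! l) = (if Suc l < n then B + q ! Suc l else 0) +
           (if 0 < l then B + q ! (l - 1) else 0)"
  using nbr_sum_path[OF es_neq es_distinct es_q q(1), of l B] length_q by simp

lemma ex_q: "u < n \<Longrightarrow> \<exists>l<n. u = q ! l"
  using q length_q by (metis in_set_conv_nth lessThan_iff)

text \<open>Two neighbours contribute at most \<open>2 (3 n + 1) + 2 (n - 1) = 8 n\<close>.\<close>

lemma nbr_sum_le: 
  assumes "u < n"
  shows "nbr_sum B es u \<le> 8 * n"
proof -
  obtain l where l: "l < n" "u = q ! l" using ex_q assms by blast
  then have "q ! (l - 1) < n" "Suc l < n \<Longrightarrow> q ! Suc l < n" using q_less by auto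
  then show ?thesis using nbr_sum_q[OF l(1)] l(2) n by (auto split: if_splits)
qed

lemma nbr_sum_less_iff:
  assumes "l < n"
  shows "nbr_sum B es (q ! l) < 2 * B \<longleftrightarrow> l = 0 \<or> Suc l = n"
proof (cases "l = 0 \<or> Suc l = n")
  case True
  moreover have "q ! (l - 1) < n" "Suc l < n \<Longrightarrow> q ! Suc l < n" using q_less assms by auto
  ultimately show ?thesis using nbr_sum_q[OF assms] by (auto split: if_splits)
next
  case False
  then show ?thesis using assms nbr_sum_q[of l] by auto
qed

definition input :: "(nat \<Rightarrow> int) \<Rightarrow> bool" where
  "input m \<longleftrightarrow> m 0 = int n \<and> m 1 = int W \<and> (\<forall>u<n. m (3 + u) = int (t u) + 1) \<and>
     (\<forall>j<n - 1. m (n + 3 + 2 * j) = int (fst (es ! j)) \<and> m (n + 4 + 2 * j) = int (snd (es ! j))) \<and>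
     (\<forall>a\<ge>B. m a = 0)"

text \<open>The zeros above \<open>4 n\<close> are carried along for the bucket counters, which no
  later phase clears.\<close>

definition edges_inv :: "nat \<Rightarrow> ram_state \<Rightarrow> bool" where
  "edges_inv j = (\<lambda>(r, m). bases n W r \<and> r 7 = int n + 3 + 2 * int j \<and>
     (\<forall>u<n. m (3 + u) = int (t u) + 1) \<and>
     (\<forall>j<n - 1. m (n + 3 + 2 * j) = int (fst (es ! j)) \<and> m (n + 4 + 2 * j) = int (snd (es ! j))) \<and>
     (\<forall>u<n. m (B + u) = int (nbr_sum B (take j es) u)) \<and>
     (\<forall>a>4 * n. m a = 0))"

lemma setup_bases:
  assumes "input m"
  shows "runs M setup_bases (r, m) (cost setup_bases) (edges_inv 0)"
  by (rule runs_if_wp) (use assms M n in \<open>auto simp: setup_bases_def edges_inv_def bases_def input_def nbr_sum_def\<close>)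

lemma edges_step:
  assumes j: "j < n - 1" and inv: "edges_inv j s"
  shows "runs M add_edge s (cost add_edge) (edges_inv (Suc j))"
proof -
  obtain r m where s: "s = (r, m)" by fastforce
  obtain u v where uv: "es ! j = (u, v)" by fastforce
  then have "(u, v) \<in> set es" using nth_mem[of j es] j length_es by simp
  then have u: "u < n" and v: "v < n" and ne: "u \<noteq> v" using es_less es_neq by auto
  have I: "bases n W r" "r 7 = int n + 3 + 2 * int j" "\<forall>u<n. m (3 + u) = int (t u) + 1"
     "\<forall>j<n - 1. m (n + 3 + 2 * j) = int (fst (es ! j)) \<and> m (n + 4 + 2 * j) = int (snd (es ! j))"
     "\<forall>u<n. m (B + u) = int (nbr_sum B (take j es) u)"
     "\<forall>a>4 * n. m a = 0"
    using inv unfolding edges_inv_def s by auto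
  have mu: "m (nat (r 7)) = int u" "m (nat (r 7 + 1)) = int v" 
    using I j uv by (auto simp: nat_add_distrib nat_mult_distrib ac_simps)
  have nu: "nat (int u + (3 * int n + 1)) = B + u" "nat (int v + (3 * int n + 1)) = B + v" by auto
  have step: "nbr_sum B (take (Suc j) es) i = nbr_sum B (take j es) i + 
     ((if u = i then B + v else 0) + (if v = i then B + u else 0))" for i
    using nbr_sum_take_Suc[OF _ uv] j length_es by simp
  have le: "nbr_sum B (take (Suc j) es) i \<le> 8 * n" if "i < n" for i
    using nbr_sum_take_le nbr_sum_le[OF that] order_trans by blast
  have le: "nbr_sum B (take j es) u + (B + v) \<le> 8 * n" "nbr_sum B (take j es) v + (B + u) \<le> 8 * n"
    using le[OF u] le[OF v] ne unfolding step by auto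
  have "Suc j < n" using j by simp
  define S where "S = nbr_sum B (take j es)"
  \<comment> \<open>Since \<open>u \<noteq> v\<close>, the first store does not affect the second
    load.\<close>
  define m' where "m' = m(B + u := int (S u) + (int v + (3 * int n + 1)), 
      B + v := int (S v) + (int u + (3 * int n + 1)))"
  have "runs M add_edge s (cost add_edge) (\<lambda>(r', m''). m'' = m' \<and> r' 7 = r 7 + 2 \<and> bases n W r')"
    unfolding s
    by (rule runs_if_wp) (use I(1,2,5) mu u v M le ne \<open>Suc j < n\<close> in \<open>simp add: add_edge_def bases_def nu m'_def S_def\<close>)
  then show ?thesis
  proof (rule runs_mono[OF _ order_refl])
    fix s' assume "case s' of (r', m'') \<Rightarrow> m'' = m' \<and> r' 7 = r 7 + 2 \<and> bases n W r'"
    then obtain r' where r': "s' = (r', m')" "r' 7 = r 7 + 2" "bases n W r'" by auto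
    have "\<forall>i<n. m' (B + i) = int (nbr_sum B (take (Suc j) es) i)"
      using ne I(5) step by (simp add: m'_def S_def)
    moreover have "\<forall>a<B. m' a = m a" "\<forall>a>4 * n. m' a = 0"
      using I(6) u v by (simp_all add: m'_def)
    ultimately show "edges_inv (Suc j) s'"
      using r' I(2-4) by (simp add: edges_inv_def)
  qed
qed

text \<open>The scan follows the numbering and not the path, so either end may be the one recorded.
  The last disjunct covers the time before an end is met.\<close>

definition endpoint_inv :: "nat \<Rightarrow> ram_state \<Rightarrow> bool" where
  "endpoint_inv j = (\<lambda>(r, m). bases n W r \<and> r 7 = 3 * int n + 1 + int j \<and> r 10 = 6 * int n + 2 \<and>
     (\<forall>u<n. m (3 + u) = int (t u) + 1) \<and> (\<forall>u<n. m (B + u) = int (nbr_sum B es u)) \<and>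
     (\<forall>a>4 * n. m a = 0) \<and>
     ((\<exists>l<n. (l = 0 \<or> Suc l = n) \<and> r 9 = 3 * int n + 1 + int (q ! l)) \<or>
      (\<forall>u<j. 2 * B \<le> nbr_sum B es u)))"

lemma endpoint_init:
  assumes "edges_inv (n - 1) s"
  shows "runs M (block [Move 7 (Reg 3), Add 10 (Reg 3) (Reg 3)]) s 3 (endpoint_inv 0)"
proof -
  obtain r m where s: "s = (r, m)" by fastforce
  have "wp M (block [Move 7 (Reg 3), Add 10 (Reg 3) (Reg 3)]) (endpoint_inv 0) s"
    using assms M n length_es unfolding s by (simp add: edges_inv_def bases_def endpoint_inv_def)
  from runs_if_wp[OF this] show ?thesis by (simp add: numeral_eq_Suc)
qed

lemma endpoint_step:
  assumes j: "j < n" and inv: "endpoint_inv j s"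
  shows "runs M test_endpoint s (cost test_endpoint) (endpoint_inv (Suc j))"
proof -
  obtain r m where s: "s = (r, m)" by fastforce
  have I: "bases n W r" "r 7 = 3 * int n + 1 + int j" "r 10 = 6 * int n + 2"
    "\<forall>u<n. m (3 + u) = int (t u) + 1" "\<forall>u<n. m (B + u) = int (nbr_sum B es u)"
     "\<forall>a>4 * n. m a = 0"
     "(\<exists>l<n. (l = 0 \<or> Suc l = n) \<and> r 9 = 3 * int n + 1 + int (q ! l)) \<or>
      (\<forall>u<j. 2 * B \<le> nbr_sum B es u)"
    using inv unfolding endpoint_inv_def s by auto
  have "nat (r 7) = B + j" using I by simp
  then have mj: "m (nat (r 7)) = int (nbr_sum B es j)" using I(5) j by simp
  have "runs M test_endpoint s (cost test_endpoint) (\<lambda>(r', m'). m' = m \<and> r' 7 = r 7 + 1 \<and> 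
    r' 10 = r 10 \<and> bases n W r' \<and> r' 9 = (if nbr_sum B es j < 2 * B then r 7 else r 9))"
    unfolding s
    by (rule runs_if_wp) (use I(1-3) mj M j in \<open>simp add: test_endpoint_def bases_def\<close>)
  then show ?thesis
  proof (rule runs_mono[OF _ order_refl])
    fix s' assume "case s' of (r', m') \<Rightarrow> m' = m \<and> r' 7 = r 7 + 1 \<and> 
       r' 10 = r 10 \<and> bases n W r' \<and> r' 9 = (if nbr_sum B es j < 2 * B then r 7 else r 9)"
    then obtain r' where r': "s' = (r', m)" "r' 7 = r 7 + 1" "r' 10 = r 10" "bases n W r'"
       "r' 9 = (if nbr_sum B es j < 2 * B then r 7 else r 9)" by auto
    have "(\<exists>l<n. (l = 0 \<or> Suc l = n) \<and> r' 9 = 3 * int n + 1 + int (q ! l)) \<or>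
      (\<forall>u<Suc j. 2 * B \<le> nbr_sum B es u)"
    proof (cases "nbr_sum B es j < 2 * B")
      case True
      obtain l where "l < n" "j = q ! l" using ex_q[OF j] by blast
      then show ?thesis using True nbr_sum_less_iff[of l] r'(5) I(2) by auto
    next
      case False
      then show ?thesis using I(7) r'(5) by (auto simp: less_Suc_eq)
    qed
    then show "endpoint_inv (Suc j) s'"
      using r' I by (simp add: endpoint_inv_def)
  qed
qed

text \<open>\<open>e\<close> names the content of register 9, which this phase leaves alone, so the
  end \<open>l\<close> can be fixed before the loop.\<close>

definition times_inv :: "int \<Rightarrow> nat \<Rightarrow> ram_state \<Rightarrow> bool" where
  "times_inv e j = (\<lambda>(r, m). bases n W r \<and> r 7 = int j \<and> r 9 = e \<and>
     r 10 = int (j div W) \<and> r 11 = int (j mod W) \<and> r 12 = int (j div W mod 2) \<and>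
     (\<forall>u<n. m (3 + u) = int (t u) + 1) \<and> (\<forall>u<n. m (B + u) = int (nbr_sum B es u)) \<and>
     (\<forall>x<j. m (4 * n + 1 + x) = int (x div W) \<and> m (5 * n + 1 + x) = int (x div W mod 2)) \<and>
     (\<forall>a>6 * n. m a = 0))"

lemma times_init:
  assumes "endpoint_inv n s"
  shows "runs M (block [Move 7 (Imm 0), Move 10 (Imm 0), Move 11 (Imm 0), Move 12 (Imm 0)]) s 5
    (\<lambda>s. \<exists>l<n. (l = 0 \<or> Suc l = n) \<and> times_inv (3 * int n + 1 + int (q ! l)) 0 s)"
proof -
  obtain r m where s: "s = (r, m)" by fastforce
  \<comment> \<open>After a full scan an end must have been recorded, as \<open>q ! 0\<close> is
    one.\<close>
  have "nbr_sum B es (q ! 0) < 2 * B" using nbr_sum_less_iff[of 0] n by simp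
  then have "\<not> (\<forall>u<n. 2 * B \<le> nbr_sum B es u)" using q_less[OF n] by force
  then obtain l where l: "l < n" "l = 0 \<or> Suc l = n" "r 9 = 3 * int n + 1 + int (q ! l)"
    using assms unfolding endpoint_inv_def s by blast
  have "wp M (block [Move 7 (Imm 0), Move 10 (Imm 0), Move 11 (Imm 0), Move 12 (Imm 0)]) 
     (times_inv (3 * int n + 1 + int (q ! l)) 0) s"
    using assms M n l unfolding s by (simp add: endpoint_inv_def bases_def times_inv_def)
  from runs_if_wp[OF this] have "runs M (block [Move 7 (Imm 0), Move 10 (Imm 0), Move 11 (Imm 0), Move 12 (Imm 0)])
     s 5 (times_inv (3 * int n + 1 + int (q ! l)) 0)" by (simp add: numeral_eq_Suc)
  then show ?thesis by (rule runs_mono) (use l in auto)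
qed

lemma times_step:
  assumes j: "j < n" and inv: "times_inv e j s"
  shows "runs M next_time s (cost next_time) (times_inv e (Suc j))"
proof -
  obtain r m where s: "s = (r, m)" by fastforce
  have I: "bases n W r" "r 7 = int j" "r 9 = e"
     "r 10 = int (j div W)" "r 11 = int (j mod W)" "r 12 = int (j div W mod 2)"
     "\<forall>u<n. m (3 + u) = int (t u) + 1" "\<forall>u<n. m (B + u) = int (nbr_sum B es u)"
     "\<forall>x<j. m (4 * n + 1 + x) = int (x div W) \<and> m (5 * n + 1 + x) = int (x div W mod 2)"
     "\<forall>a>6 * n. m a = 0"
    using inv unfolding times_inv_def s by auto
  define b w y where "b = j div W" "w = j mod W" "y = j div W mod 2"
  have bwy: "b \<le> j" "w < W" "y < 2" using W by (simp_all add: b_w_y_def)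
  have Suc_div: "Suc j div W = (if Suc w < W then b else Suc b)" "Suc j mod W = (if Suc w < W then Suc w else 0)"
    using mod_less_divisor[OF W, of j] unfolding b_w_y_def by (auto simp: div_Suc mod_Suc)
  have parity: "Suc b mod 2 = 1 - y" unfolding b_w_y_def by (simp add: mod_Suc)
  have addr: "nat (4 * int n + 1 + int j) = 4 * n + 1 + j" "nat (5 * int n + (1 + int j)) = 5 * n + 1 + j"
    by simp_all
  define m' where "m' = m(4 * n + 1 + j := int b, 5 * n + 1 + j := int y)"
  have r: "r 10 = int b" "r 11 = int w" "r 12 = int y" using I(4-6) by (simp_all add: b_w_y_def)
  have "runs M next_time s (cost next_time) (\<lambda>(r', m''). m'' = m' \<and> r' 7 = r 7 + 1 \<and> 
    r' 9 = r 9 \<and> bases n W r' \<and> r' 10 = int (if Suc w < W then b else Suc b) \<and> 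
    r' 11 = int (if Suc w < W then Suc w else 0) \<and> r' 12 = int (if Suc w < W then y else 1 - y))"
    unfolding s
    by (rule runs_if_wp) (use I(1,2) r bwy M j in \<open>simp add: next_time_def bases_def m'_def of_nat_diff addr\<close>)
  then show ?thesis
  proof (rule runs_mono[OF _ order_refl])
    fix s' assume "case s' of (r', m'') \<Rightarrow> m'' = m' \<and> r' 7 = r 7 + 1 \<and> 
    r' 9 = r 9 \<and> bases n W r' \<and> r' 10 = int (if Suc w < W then b else Suc b) \<and> 
    r' 11 = int (if Suc w < W then Suc w else 0) \<and> r' 12 = int (if Suc w < W then y else 1 - y)"
    then obtain r' where r': "s' = (r', m')" "r' 7 = r 7 + 1" "r' 9 = r 9" "bases n W r'"
       "r' 10 = int (Suc j div W)" "r' 11 = int (Suc j mod W)" 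
       "r' 12 = int (if Suc w < W then y else 1 - y)" using Suc_div by auto
    have "r' 12 = int (Suc j div W mod 2)"
      unfolding r' Suc_div using parity by (simp add: b_w_y_def)
    moreover have "\<forall>x<Suc j. m' (4 * n + 1 + x) = int (x div W) \<and> m' (5 * n + 1 + x) = int (x div W mod 2)"
      using I(9) j by (auto simp: m'_def b_w_y_def less_Suc_eq)
    moreover have "\<forall>a\<le>4 * n. m' a = m a" "\<forall>a>6 * n. m' a = 0"
      using I(10) j by (simp_all add: m'_def)
    ultimately show "times_inv e (Suc j) s'"
      using r' I by (simp add: times_inv_def)
  qed
qed

text \<open>The counter for the bucket of \<open>q ! j\<close> equals \<open>earlier_equal\<close>
  at \<open>j\<close>, hence is the first coordinate to write. Register 9 is constrained only for
  \<open>j < n\<close>, as the last vertex has no successor.\<close>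

definition place_inv :: "nat \<Rightarrow> ram_state \<Rightarrow> bool" where
  "place_inv j = (\<lambda>(r, m). bases n W r \<and> r 7 = int j \<and>
     r 8 = int (if j = 0 then 0 else B + q ! (j - 1)) \<and> (j < n \<longrightarrow> r 9 = int (B + q ! j)) \<and>
     (\<forall>u<n. m (3 + u) = int (t u) + 1) \<and> (\<forall>u<n. m (B + u) = int (nbr_sum B es u)) \<and>
     (\<forall>x<n. m (4 * n + 1 + x) = int (x div W) \<and> m (5 * n + 1 + x) = int (x div W mod 2)) \<and>
     (\<forall>b<n. m (6 * n + 1 + b) = int (card {i. i < j \<and> t (q ! i) div W = b})) \<and>
     (\<forall>i<j. m (7 * n + 1 + 2 * q ! i) = int (earlier_equal (\<lambda>k. t (q ! k) div W) i) \<and>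
        m (7 * n + 2 + 2 * q ! i) = int (t (q ! i) div W mod 2)))"

lemma place_init:
  assumes "times_inv (3 * int n + 1 + int (q ! 0)) n s"
  shows "runs M (block [Move 7 (Imm 0), Move 8 (Imm 0)]) s 3 (place_inv 0)"
proof -
  obtain r m where s: "s = (r, m)" by fastforce
  have "wp M (block [Move 7 (Imm 0), Move 8 (Imm 0)]) (place_inv 0) s"
    using assms M n unfolding s by (simp add: times_inv_def bases_def place_inv_def)
  from runs_if_wp[OF this] show ?thesis by (simp add: numeral_eq_Suc)
qed

lemma place_step:
  assumes j: "j < n" and inv: "place_inv j s"
  shows "runs M place_vertex s (cost place_vertex) (place_inv (Suc j))"
proof -
  obtain r m where s: "s = (r, m)" by fastforce
  let ?f = "\<lambda>k. t (q ! k) div W"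
  define pr where "pr = (if j = 0 then 0 else B + q ! (j - 1))"
  define u where "u = q ! j"
  define b where "b = t u div W"
  define x where "x = earlier_equal ?f j"
  have I: "bases n W r" "r 7 = int j" "r 8 = int pr" "r 9 = int (B + u)"
     "\<forall>u<n. m (3 + u) = int (t u) + 1" "\<forall>u<n. m (B + u) = int (nbr_sum B es u)"
     "\<forall>x<n. m (4 * n + 1 + x) = int (x div W) \<and> m (5 * n + 1 + x) = int (x div W mod 2)"
     "\<forall>b<n. m (6 * n + 1 + b) = int (card {i. i < j \<and> ?f i = b})"
     "\<forall>i<j. m (7 * n + 1 + 2 * q ! i) = int (earlier_equal ?f i) \<and>
        m (7 * n + 2 + 2 * q ! i) = int (?f i mod 2)"
    using inv j unfolding place_inv_def s pr_def u_def by auto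
  have u: "u < n" using q_less[OF j] by (simp add: u_def)
  have tu: "t u < n" by (rule t[OF u])
  have b: "b < n" using tu unfolding b_def by (meson div_le_dividend le_less_trans)
  have "x \<le> card {..<j}" unfolding x_def earlier_equal_def by (rule card_mono) auto
  then have x: "x < n" using j by simp
  have "q ! (j - 1) < n" using q_less[of "j - 1"] j by simp
  then have pr: "pr \<le> 4 * n" unfolding pr_def by auto
  have S: "nbr_sum B es u \<le> 8 * n" by (rule nbr_sum_le[OF u])
  have nxt: "nbr_sum B es u = B + q ! Suc j + pr" if "Suc j < n"
    using nbr_sum_q[OF j] that by (simp add: u_def pr_def)
  have mem: "m (B + u) = int (nbr_sum B es u)" "m (3 + u) = int (t u) + 1"
    "m (4 * n + 1 + t u) = int b" "m (5 * n + 1 + t u) = int (b mod 2)"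
    "m (6 * n + 1 + b) = int x"
    using I(5-8) u tu b by (simp_all add: b_def x_def earlier_equal_def u_def)
  have addr: "nat (1 + (3 * int n + int u)) = B + u" "nat (int u + 3) = 3 + u"
    "nat (int (t u) + (4 * int n + 1)) = 4 * n + 1 + t u"
    "nat (5 * int n + (int (t u) + 1)) = 5 * n + 1 + t u"
    "nat (int b + (6 * int n + 1)) = 6 * n + 1 + b"
    "nat (2 * int u + (7 * int n + 1)) = 7 * n + 1 + 2 * u"
    "nat (2 + (2 * int u + 7 * int n)) = 7 * n + 2 + 2 * u"
    by simp_all
  define m' where "m' = m(7 * n + 1 + 2 * u := int x, 7 * n + 2 + 2 * u := int (b mod 2),
     6 * n + 1 + b := int x + 1)"
  define fetched where "fetched = (\<lambda>(r', m''). m'' = m \<and> bases n W r' \<and> r' 7 = r 7 \<and> r' 8 = r 8 \<and>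
     r' 9 = r 9 \<and> r' 10 = int (nbr_sum B es u) \<and> r' 12 = int b + (6 * int n + 1) \<and>
     r' 13 = int u \<and> r' 14 = int (b mod 2) \<and> r' 15 = int x)"
  define written where "written = (\<lambda>(r', m''). m'' = m' \<and> bases n W r' \<and>
     r' 7 = r 7 + 1 \<and> r' 8 = r 9 \<and> r' 9 = int (nbr_sum B es u) - int pr)"
  have "wp M fetch_vertex fetched (r, m)"
    using I(1-4) M u b tu mem by (simp add: fetch_vertex_def bases_def fetched_def addr)
  then have fetch: "runs M fetch_vertex s (cost fetch_vertex) fetched"
    unfolding s by (rule runs_if_wp)
  have "runs M write_vertex s' (cost write_vertex) written" if "fetched s'" for s'
  proof -
    from that obtain r' where r': "s' = (r', m)" "bases n W r'" "r' 7 = int j" "r' 8 = int pr"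
      "r' 9 = 3 * int n + 1 + int u" "r' 10 = int (nbr_sum B es u)" "r' 12 = int b + (6 * int n + 1)"
      "r' 13 = int u" "r' 14 = int (b mod 2)" "r' 15 = int x"
      using I(2-4) by (auto simp: fetched_def)
    have "b mod 2 \<le> 1" by linarith
    then have "wp M write_vertex written (r', m)"
      using r'(2-) I(2-4) M u b x pr S j n 
      by (simp add: write_vertex_def bases_def written_def m'_def addr)
    then show ?thesis unfolding r'(1) by (rule runs_if_wp)
  qed
  then have "runs M place_vertex s (cost place_vertex) written"
    unfolding place_vertex_def cost.simps by (rule runs_Seq[OF fetch])
  then show ?thesis
  proof (rule runs_mono[OF _ order_refl])
    fix s' assume "written s'"
    then obtain r' where r': "s' = (r', m')" "bases n W r'" "r' 7 = r 7 + 1" "r' 8 = r 9"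
       "r' 9 = int (nbr_sum B es u) - int pr" unfolding written_def by auto
    have low: "\<forall>a\<le>6 * n. m' a = m a" using u b by (simp add: m'_def)
    have counts: "m' (6 * n + 1 + c) = int (card {i. i < Suc j \<and> ?f i = c})" if c: "c < n" for c
    proof (cases "c = b")
      case True
      have "{i. i < Suc j \<and> ?f i = b} = insert j {i. i < j \<and> ?f i = b}"
        by (auto simp: less_Suc_eq b_def u_def)
      then show ?thesis using True by (simp add: m'_def x_def earlier_equal_def b_def u_def)
    next
      case False
      then have "{i. i < Suc j \<and> ?f i = c} = {i. i < j \<and> ?f i = c}"
        by (auto simp: less_Suc_eq b_def u_def)
      then show ?thesis using False c I(8) by (simp add: m'_def)
    qed
    have out: "m' (7 * n + 1 + 2 * q ! i) = int (earlier_equal ?f i) \<and>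
        m' (7 * n + 2 + 2 * q ! i) = int (?f i mod 2)" if "i < Suc j" for i
    proof (cases "i = j")
      case True
      then show ?thesis using b by (simp add: m'_def x_def b_def u_def)
    next
      case False
      then have i: "i < j" using that by simp
      then have ne: "q ! i \<noteq> u" using j q(1) length_q by (simp add: u_def nth_eq_iff_index_eq)
      \<comment> \<open>By parity, a cell for a first coordinate is never one for a second
        coordinate.\<close>
      have "Suc (2 * q ! i) \<noteq> 2 * u" "2 * q ! i \<noteq> Suc (2 * u)" by presburger+
      then show ?thesis using ne i I(9) b by (simp add: m'_def)
    qed
    have "Suc j < n \<Longrightarrow> r' 9 = int (B + q ! Suc j)" using r' nxt by simp
    then show "place_inv (Suc j) s'"
      using r' I low counts out u_def by (simp add: place_inv_def)
  qed
qed

lemma edges_loop: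
  assumes "edges_inv 0 s"
  shows "runs M (WhileLess (Reg 7) (Reg 3) add_edge) s
    ((n - 1) * (cost add_edge + 1) + 1) (edges_inv (n - 1))"
  by (rule runs_WhileLess[OF _ edges_step assms]) (auto simp: edges_inv_def bases_def)

lemma endpoint_loop:
  assumes "endpoint_inv 0 s"
  shows "runs M (WhileLess (Reg 7) (Reg 4) test_endpoint) s
    (n * (cost test_endpoint + 1) + 1) (endpoint_inv n)"
  by (rule runs_WhileLess[OF _ endpoint_step assms]) (auto simp: endpoint_inv_def bases_def)

lemma times_loop:
  assumes "times_inv e 0 s"
  shows "runs M (WhileLess (Reg 7) (Reg 1) next_time) s
    (n * (cost next_time + 1) + 1) (times_inv e n)"
  by (rule runs_WhileLess[OF _ times_step assms]) (auto simp: times_inv_def bases_def)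

lemma place_loop:
  assumes "place_inv 0 s"
  shows "runs M (WhileLess (Reg 7) (Reg 1) place_vertex) s
    (n * (cost place_vertex + 1) + 1) (place_inv n)"
  by (rule runs_WhileLess[OF _ place_step assms]) (auto simp: place_inv_def bases_def)

definition placed :: "nat list \<Rightarrow> ram_state \<Rightarrow> bool" where
  "placed q' = (\<lambda>(r, m). r 0 = 7 * int n + 1 \<and>
     (\<forall>i<n. m (7 * n + 1 + 2 * q' ! i) = int (earlier_equal (\<lambda>k. t (q' ! k) div W) i) \<and>
        m (7 * n + 2 + 2 * q' ! i) = int (t (q' ! i) div W mod 2)))"

lemma place_phase:
  assumes "times_inv (3 * int n + 1 + int (q ! 0)) n s"
  shows "runs M (Seq (block [Move 7 (Imm 0), Move 8 (Imm 0)])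
     (WhileLess (Reg 7) (Reg 1) place_vertex)) s (3 + (n * (cost place_vertex + 1) + 1)) (placed q)"
proof (rule runs_mono[OF _ order_refl])
  show "runs M (Seq (block [Move 7 (Imm 0), Move 8 (Imm 0)])
     (WhileLess (Reg 7) (Reg 1) place_vertex)) s (3 + (n * (cost place_vertex + 1) + 1)) (place_inv n)"
    using place_init[OF assms] place_loop by (rule runs_Seq)
qed (auto simp: place_inv_def placed_def bases_def)

lemma path_input_rev: "path_input n W M t es (rev q)"
  using path_input_axioms unfolding path_input_def by (simp add: consecutive_pairs_rev)

lemma runs_path_story_prog:
  assumes "input m"
  shows "runs M path_story_prog (r, m) (200 * n) (\<lambda>s. placed q s \<or> placed (rev q) s)"
proof -
  let ?T = "\<lambda>j s. \<exists>l<n. (l = 0 \<or> Suc l = n) \<and> times_inv (3 * int n + 1 + int (q ! l)) j s"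
  have times: "runs M (WhileLess (Reg 7) (Reg 1) next_time) s (n * (cost next_time + 1) + 1) (?T n)"
    if T: "?T 0 s" for s
  proof -
    from T obtain l where "l < n" "l = 0 \<or> Suc l = n" "times_inv (3 * int n + 1 + int (q ! l)) 0 s" by blast
    then show ?thesis using times_loop by (blast intro: runs_mono)
  qed
  have place: "runs M (Seq (block [Move 7 (Imm 0), Move 8 (Imm 0)])
     (WhileLess (Reg 7) (Reg 1) place_vertex)) s (3 + (n * (cost place_vertex + 1) + 1)) 
     (\<lambda>s. placed q s \<or> placed (rev q) s)"
    if T: "?T n s" for s
  proof -
    from T obtain l where l: "l < n" "l = 0 \<or> Suc l = n"
      "times_inv (3 * int n + 1 + int (q ! l)) n s" by blast
    from l(2) show ?thesis
    proof
      assume "l = 0"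
      with l(3) show ?thesis by (intro runs_mono[OF place_phase order_refl]) auto
    next
      assume "Suc l = n"
      \<comment> \<open>\<open>times_inv\<close> refers to the edges but not to \<open>q\<close>, so
        it is the same predicate in the instance for \<open>rev q\<close>, whose walk starts at the
        last vertex of \<open>q\<close>.\<close>
      then have "q ! l = rev q ! 0" using n length_q by (simp add: rev_nth flip: \<open>Suc l = n\<close>)
      with l(3) show ?thesis
        by (intro runs_mono[OF path_input.place_phase[OF path_input_rev] order_refl]) auto
    qed
  qed
  show ?thesis
  proof (rule runs_mono)
    show "runs M path_story_prog (r, m)
      (cost setup_bases + ((n - 1) * (cost add_edge + 1) + 1 + (3 + (n * (cost test_endpoint + 1) + 1 +
       (5 + (n * (cost next_time + 1) + 1 + (3 + (n * (cost place_vertex + 1) + 1))))))))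
      (\<lambda>s. placed q s \<or> placed (rev q) s)"
      unfolding path_story_prog_def
      by (intro runs_Seq[OF setup_bases[OF assms]] runs_Seq[OF edges_loop]
        runs_Seq[OF endpoint_init] runs_Seq[OF endpoint_loop] runs_Seq[OF times_init]
        runs_Seq[OF times] place)
    \<comment> \<open>The left side evaluates to \<open>58 n + 12\<close>, and \<open>n > 0\<close>
      absorbs the constant.\<close>
    show "cost setup_bases + ((n - 1) * (cost add_edge + 1) + 1 + (3 + (n * (cost test_endpoint + 1) + 1 +
       (5 + (n * (cost next_time + 1) + 1 + (3 + (n * (cost place_vertex + 1) + 1))))))) \<le> 200 * n"
      using n by (simp add: setup_bases_def add_edge_def test_endpoint_def next_time_def place_vertex_def
          fetch_vertex_def write_vertex_def)
  qed
qed

end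

section \<open>From encoded stories to the program and back\<close>

lemma length_concat_pairs: "length (concat (map (\<lambda>(i, j). [i, j]) es)) = 2 * length es"
  by (induction es) auto

lemma nth_concat_pairs:
  assumes "k < length es"
  shows "concat (map (\<lambda>(i, j). [i, j]) es) ! (2 * k) = fst (es ! k)"
    and "concat (map (\<lambda>(i, j). [i, j]) es) ! Suc (2 * k) = snd (es ! k)"
proof -
  have "concat (map (\<lambda>(i, j). [i, j]) es) ! (2 * k) = fst (es ! k) \<and>
     concat (map (\<lambda>(i, j). [i, j]) es) ! Suc (2 * k) = snd (es ! k)"
    using assms
  proof (induction es arbitrary: k)
    case (Cons e es)
    then show ?case by (cases k; cases e) auto
  qed simp
  then show "concat (map (\<lambda>(i, j). [i, j]) es) ! (2 * k) = fst (es ! k)"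
    and "concat (map (\<lambda>(i, j). [i, j]) es) ! Suc (2 * k) = snd (es ! k)" by auto
qed

lemma earlier_equal_cong:
  assumes "\<And>i. i \<le> k \<Longrightarrow> f i = g i"
  shows "earlier_equal f k = earlier_equal g k"
  unfolding earlier_equal_def using assms by (intro arg_cong[of _ _ card]) auto

text \<open>Pulling the path back along the enumeration \<open>vs\<close> gives a path on vertex
  numbers, the setting in which the program is analysed.\<close>

lemma encodes_storyE:
  assumes "graph_story V E \<tau> W" "path_graph V E" "encodes_story inp vs V E \<tau> W"
    and M: "20 * (card V + W) \<le> M"
  obtains q es where 
    "path_input (card V) W M (\<lambda>u. \<tau> (vs ! u) - 1) es q"
    "path_input.input (card V) W (\<lambda>u. \<tau> (vs ! u) - 1) es (snd (init_state inp))"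
    "E = consecutive_pairs (map ((!) vs) q)" "vs \<noteq> []"
proof -
  let ?n = "length vs" and ?f = "(!) vs" and ?pair = "\<lambda>(u, v). {u, v}" and ?t = "\<lambda>u. \<tau> (vs ! u) - 1"
  have vs: "distinct vs" "set vs = V" using assms(3) by (auto simp: encodes_story_def)
  have card: "card V = ?n" using distinct_card[OF vs(1)] vs(2) by simp
  have \<tau>: "bij_betw \<tau> V {1..?n}" and W: "W > 0"
    using assms(1) card by (auto simp: graph_story_def)
  obtain es :: "(nat \<times> nat) list" where es: "\<forall>(i, j) \<in> set es. i < ?n \<and> j < ?n"
     "distinct (map (\<lambda>(i, j). {vs ! i, vs ! j}) es)"
     "set (map (\<lambda>(i, j). {vs ! i, vs ! j}) es) = E"
     "inp = [?n, W, length es] @ map \<tau> vs @ concat (map (\<lambda>(i, j). [i, j]) es)"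
    using assms(3) unfolding encodes_story_def by blast
  obtain p where p: "p \<noteq> []" "distinct p" "set p = V" "E = consecutive_pairs p"
    using assms(2) unfolding path_graph_def consecutive_pairs_def by blast
  have bij: "bij_betw ?f {..<?n} V" using bij_betw_nth[OF vs(1) refl] vs(2) by blast
  then have inj: "inj_on ?f {..<?n}" by (rule bij_betw_imp_inj_on)
  define q where "q = map (inv_into {..<?n} ?f) p"
  have map_q: "map ?f q = p"
    unfolding q_def map_map using p(3) bij
    by (intro map_idI) (simp add: bij_betw_inv_into_right)
  have distinct_q: "distinct q" using p(2) map_q by (metis distinct_map)
  have set_q: "set q = {..<?n}"
    unfolding q_def using p(3) bij by (simp add: bij_betw_inv_into bij_betw_imp_surj_on)
  have pairs: "map (\<lambda>(i, j). {vs ! i, vs ! j}) es = map ((`) ?f) (map ?pair es)"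
    by auto
  have distinct_es: "distinct (map ?pair es)"
    using es(2) unfolding pairs by (metis distinct_map)
  have "(`) ?f ` set (map ?pair es) = set (map (\<lambda>(i, j). {vs ! i, vs ! j}) es)"
    by (simp only: pairs set_map)
  also have "\<dots> = (`) ?f ` consecutive_pairs q"
    using es(3) p(4) consecutive_pairs_map[of ?f q] by (simp only: map_q)
  finally have "(`) ?f ` set (map ?pair es) = (`) ?f ` consecutive_pairs q" .
  moreover have "set (map ?pair es) \<subseteq> Pow {..<?n}" using es(1) by auto
  moreover have "consecutive_pairs q \<subseteq> Pow {..<?n}"
  proof
    fix e assume "e \<in> consecutive_pairs q"
    then obtain i where "Suc i < length q" "e = {q ! i, q ! Suc i}"
      by (auto simp: consecutive_pairs_def)
    then show "e \<in> Pow {..<?n}"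
      using nth_mem[of i q] nth_mem[of "Suc i" q] set_q by auto
  qed
  \<comment> \<open>Taking images under \<open>(!) vs\<close> is injective on sets of valid indices,
    so it can be cancelled.\<close>
  ultimately have es_q: "set (map ?pair es) = consecutive_pairs q"
    using inj_on_image_eq_iff[OF inj_on_image_Pow[OF inj]] by simp
  have \<tau>_vs: "\<tau> (vs ! u) \<in> {1..?n}" if "u < ?n" for u
    using \<tau> vs(2) that by (metis bij_betw_apply nth_mem)
  have n: "?n > 0" using p(1,3) vs(2) by auto
  have path: "path_input ?n W M ?t es q"
  proof
    show "?t u < ?n" if "u < ?n" for u using \<tau>_vs[OF that] by auto
  qed (use n W M card distinct_q set_q es(1) distinct_es es_q in auto)
  then interpret path_input "?n" W M ?t es q .
  \<comment> \<open>\<open>3 + n + 2 (n - 1)\<close> cells, so the zeros begin exactly at the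
    neighbour table.\<close>
  have inp: "length inp = 3 * ?n + 1"
    using n length_es by (simp add: es(4) length_concat_pairs del: length_greater_0_conv)
  have inp_\<tau>: "inp ! (3 + u) = \<tau> (vs ! u)" if "u < ?n" for u
    using that by (simp add: es(4) nth_append)
  have inp_es: "inp ! (?n + 3 + 2 * j) = fst (es ! j)" "inp ! (?n + 4 + 2 * j) = snd (es ! j)"
    if "j < ?n - 1" for j
  proof -
    have "?n + 3 + 2 * j = 3 + ?n + 2 * j" "?n + 4 + 2 * j = 3 + ?n + Suc (2 * j)" by auto
    then show "inp ! (?n + 3 + 2 * j) = fst (es ! j)" "inp ! (?n + 4 + 2 * j) = snd (es ! j)"
      using nth_concat_pairs[of j es] that length_es by (simp_all add: es(4) nth_append)
  qed
  have "path_input.input ?n W ?t es (snd (init_state inp))"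
    unfolding input_def
  proof (intro conjI allI impI)
    show "snd (init_state inp) 0 = int ?n" "snd (init_state inp) 1 = int W"
      by (simp_all add: init_state_def es(4))
    show "snd (init_state inp) (3 + u) = int (?t u) + 1" if "u < ?n" for u
      using \<tau>_vs[OF that] inp inp_\<tau>[OF that] that by (simp add: init_state_def of_nat_diff)
    show "snd (init_state inp) (?n + 3 + 2 * j) = int (fst (es ! j))"
      "snd (init_state inp) (?n + 4 + 2 * j) = int (snd (es ! j))" if "j < ?n - 1" for j
      using inp inp_es[OF that] that by (auto simp: init_state_def)
    show "snd (init_state inp) a = 0" if "B \<le> a" for a
      using inp that by (simp add: init_state_def)
  qed
  moreover have "E = consecutive_pairs (map ?f q)" using p(4) map_q by simp
  ultimately show thesis using that path card n by auto
qed

theorem theorem2: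
  "\<exists>(p :: prog) (c :: nat).
     \<forall>(V :: 'a set) (E :: 'a set set) (\<tau> :: 'a \<Rightarrow> nat) (W :: nat) (vs :: 'a list) (inp :: nat list).
       graph_story V E \<tau> W \<and> path_graph V E \<and> encodes_story inp vs V E \<tau> W \<longrightarrow>
       (\<exists>k s \<Gamma>.
          exec (c * (card V + W)) p (init_state inp) k s \<and>
          k \<le> c * card V \<and>
          outputs_story s vs V \<tau> W \<Gamma> \<and>
          drawing_story V E \<tau> W \<Gamma> \<and>
          planar_story V E \<tau> W \<Gamma> \<and>
          straight_line_story V E \<tau> W \<Gamma> \<and>
          story_on_grid V E \<tau> W \<Gamma> (2 * W) (2 * W))"
proof (rule exI[of _ path_story_prog], rule exI[of _ 200], intro allI impI, elim conjE)
  fix V :: "'a set" and E \<tau> W vs inp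
  assume story: "graph_story V E \<tau> W" and path: "path_graph V E" and enc: "encodes_story inp vs V E \<tau> W"
  \<comment> \<open>The constant 200 serves both as time factor and as word-bound factor; the latter
    only has to be at least 20.\<close>
  let ?M = "200 * (card V + W)" and ?t = "\<lambda>u. \<tau> (vs ! u) - 1" and ?n = "length vs" and ?f = "(!) vs"
  obtain q0 es where q0: "path_input (card V) W ?M ?t es q0"
    "path_input.input (card V) W ?t es (snd (init_state inp))"
    "E = consecutive_pairs (map ?f q0)"
    by (rule encodes_storyE[OF story path enc, of ?M]) auto
  have vs: "distinct vs" "set vs = V" using enc by (auto simp: encodes_story_def)
  have card: "card V = ?n" using distinct_card[OF vs(1)] vs(2) by simp
  interpret q0: path_input "card V" W ?M ?t es q0 by (rule q0(1))
  obtain k r m where k: "exec ?M path_story_prog (init_state inp) k (r, m)" "k \<le> 200 * card V"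
    and placed: "q0.placed q0 (r, m) \<or> q0.placed (rev q0) (r, m)"
    using q0.runs_path_story_prog[OF q0(2), of "fst (init_state inp)"] by (auto simp: runs_def)
  obtain q where q: "distinct q" "set q = {..<?n}" "E = consecutive_pairs (map ?f q)"
    and placed: "q0.placed q (r, m)"
    using placed
  proof
    assume "q0.placed q0 (r, m)"
    then show thesis using that[of q0] q0(3) q0.q card by simp
  next
    assume "q0.placed (rev q0) (r, m)"
    then show thesis using that[of "rev q0"] q0(3) q0.q card 
      by (simp add: rev_map[symmetric] consecutive_pairs_rev)
  qed
  have out: "r 0 = 7 * int ?n + 1"
    "\<And>k. k < ?n \<Longrightarrow> m (7 * ?n + 1 + 2 * q ! k) = int (earlier_equal (\<lambda>k. ?t (q ! k) div W) k)"
    "\<And>k. k < ?n \<Longrightarrow> m (7 * ?n + 2 + 2 * q ! k) = int (?t (q ! k) div W mod 2)"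
    using placed unfolding q0.placed_def unfolding card by auto
  have length_q: "length q = ?n" using distinct_card[OF q(1)] q(2) by simp
  have bij: "bij_betw ?f {..<?n} V" using bij_betw_nth[OF vs(1) refl] vs(2) by blast
  have q_less: "q ! k < ?n" if "k < ?n" for k using nth_mem[of k q] q length_q that by auto
  \<comment> \<open>\<open>P\<close> reads the output cells themselves, so
    \<open>outputs_story\<close> holds by construction; that these cells contain the prescribed
    coordinates is what the locale interpretation checks.\<close>
  define P where "P v = (let u = inv_into {..<?n} ?f v in
     (of_int (m (7 * ?n + 1 + 2 * u)) :: real, of_int (m (7 * ?n + 2 + 2 * u)) :: real))" for v
  have P_vs: "P (vs ! u) = (of_int (m (7 * ?n + 1 + 2 * u)), of_int (m (7 * ?n + 2 + 2 * u)))"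
    if "u < ?n" for u
    using bij_betw_inv_into_left[OF bij] that by (simp add: P_def)
  interpret drawn_path_story V \<tau> W "map ?f q" P
  proof
    show "distinct (map ?f q)"
      using q bij by (simp add: distinct_map bij_betw_imp_inj_on)
    show "set (map ?f q) = V"
      using q bij by (simp add: bij_betw_imp_surj_on)
    show "bij_betw \<tau> V {1..card V}" "W > 0"
      using story by (auto simp: graph_story_def)
    show "P (map ?f q ! k) = (real (earlier_equal (\<lambda>k. (\<tau> (map ?f q ! k) - 1) div W) k),
        real ((\<tau> (map ?f q ! k) - 1) div W mod 2))" if "k < length (map ?f q)" for k
    proof -
      have k: "k < ?n" using that length_q by simp
      have "earlier_equal (\<lambda>k. (\<tau> (map ?f q ! k) - 1) div W) k = earlier_equal (\<lambda>k. ?t (q ! k) div W) k"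
        by (rule earlier_equal_cong) (use k length_q in simp)
      then show ?thesis
        using P_vs[OF q_less[OF k]] out(2,3)[OF k] k length_q by simp
    qed
  qed
  have "outputs_story (r, m) vs V \<tau> W drawing_at"
    using out(1) P_vs by (auto simp: outputs_story_def nat_add_distrib nat_mult_distrib)
  then show "\<exists>k s \<Gamma>. exec ?M path_story_prog (init_state inp) k s \<and> k \<le> 200 * card V \<and>
          outputs_story s vs V \<tau> W \<Gamma> \<and> drawing_story V E \<tau> W \<Gamma> \<and> planar_story V E \<tau> W \<Gamma> \<and>
          straight_line_story V E \<tau> W \<Gamma> \<and> story_on_grid V E \<tau> W \<Gamma> (2 * W) (2 * W)"
    using k drawing_story planar_story straight_line_story story_on_grid unfolding q(3) by blast
qed

end
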